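(* Let $L$ be an even unimodular lattice of rank $d$ and let $\mathfrak h$ be the Heisenberg sub-VOA (of central charge $d$) of the lattice VOA $V_L$. For any finite abelian group $G$ acting orthogonally on $\mathfrak h$, the dimensions of the $G$-invariant homogeneous subspaces are bounded from below by $$\dim\big(\mathfrak h_{(2)}^G\big)\ge \frac d2,\qquad \dim\big(\mathfrak h_{(3)}^G\big)\ge d .$$ The bounds are sharp: for each of the two bounds there is a finite abelian group $G$ acting orthogonally on $\mathfrak h$ for which equality holds.
   Context: The Heisenberg VOA is $\mathfrak h=\mathrm{Sym}\big(\bigoplus_{n\ge1}E_{-n}\big)$ where $E_{-n}=\{v_{-n}: v\in E\}$ is a copy of $E=L\otimes_{\mathbb Z}\mathbb C\cong\mathbb C^d$ placed in conformal weight $n$; thus $\mathfrak h_{(m)}$ is spanned by monomials $(v^1)_{-n_1}\cdots(v^k)_{-n_k}\mathfrak e_0$ with $n_1+\dots+n_k=m$, $n_i\ge 1$, $\mathfrak e_0$ being the vacuum. A group $G$ acts orthogonally on $\mathfrak h$ if it acts on the real Euclidean space $L\otimes_{\mathbb Z}\mathbb R$ by orthogonal transformations, the action being extended complex-linearly to $E$ and then to $\mathfrak h$ by $g\cdot(v^1)_{-n_1}\cdots(v^k)_{-n_k}\mathfrak e_0=(gv^1)_{-n_1}\cdots(gv^k)_{-n_k}\mathfrak e_0$. $\mathfrak h_{(m)}^G$ is the subspace of $G$-invariant vectors of $\mathfrak h_{(m)}$. *)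

theory Defs
  imports
    "HOL-Library.Poly_Mapping"
    "HOL-Algebra.Group"
    "Jordan_Normal_Form.Determinant"
begin

section \<open>Even unimodular lattices\<close>

text \<open>A positive definite lattice of rank \<open>d\<close> is taken in the Euclidean space
  \<open>L \<otimes> \<real>\<close>, identified with \<open>\<real>\<^sup>d\<close> (\<open>carrier_vec d\<close>, with \<open>\<bullet>\<close> as inner product) by the choice
  of an orthonormal basis. The columns of \<open>B\<close> form a \<open>\<int>\<close>-basis of \<open>L\<close>. The rank \<open>0\<close> is allowed.\<close>

definition is_lattice :: "nat \<Rightarrow> real vec set \<Rightarrow> bool" where
  "is_lattice d L \<longleftrightarrow>
     (\<exists>B \<in> carrier_mat d d. det B \<noteq> 0 \<and>
        L = {B *\<^sub>v map_vec real_of_int z | z. z \<in> carrier_vec d})"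

definition dual_lattice :: "nat \<Rightarrow> real vec set \<Rightarrow> real vec set" where
  "dual_lattice d L = {y \<in> carrier_vec d. \<forall>x \<in> L. x \<bullet> y \<in> \<int>}"

definition even_unimodular_lattice :: "nat \<Rightarrow> real vec set \<Rightarrow> bool" where
  "even_unimodular_lattice d L \<longleftrightarrow>
     is_lattice d L \<and> dual_lattice d L = L \<and> (\<forall>x \<in> L. \<exists>k::int. x \<bullet> x = 2 * real_of_int k)"


section \<open>The graded vector space of the Heisenberg VOA\<close>

text \<open>\<open>E = L \<otimes> \<complex>\<close> is \<open>\<complex>\<^sup>d\<close>, with standard basis \<open>e\<^sub>0, \<dots>, e\<^sub>d\<^sub>-\<^sub>1\<close>. The symmetric algebra on
  the sum of the spaces \<open>E\<^sub>-\<^sub>n\<close> is the complex polynomial algebra in the variables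
  \<open>(i, n)\<close>, standing for \<open>(e\<^sub>i)\<^sub>-\<^sub>n\<close> (with \<open>i < d\<close> and \<open>n \<ge> 1\<close>). The type below has
  a variable for every pair of natural numbers; the restrictions on \<open>i\<close> and \<open>n\<close> are imposed in
  \<open>mode\<close> and \<open>heis_weight\<close>. The polynomial \<open>1\<close> is the vacuum.\<close>

type_synonym heis = "((nat \<times> nat) \<Rightarrow>\<^sub>0 nat) \<Rightarrow>\<^sub>0 complex"

definition heis_scale :: "complex \<Rightarrow> heis \<Rightarrow> heis" where
  "heis_scale c p = Poly_Mapping.single 0 c * p"

global_interpretation heis: vector_space heis_scale
  defines heis_span = heis.span and heis_dim = heis.dim
  by unfold_locales
    (simp_all add: heis_scale_def distrib_left distrib_right single_add mult_single flip: mult.assoc)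

text \<open>\<open>mode d v n\<close> is \<open>v\<^sub>-\<^sub>n\<close>.\<close>

definition mode :: "nat \<Rightarrow> complex vec \<Rightarrow> nat \<Rightarrow> heis" where
  "mode d v n =
     (\<Sum>i<d. heis_scale (v $ i) (Poly_Mapping.single (Poly_Mapping.single (i, n) 1) 1))"

definition heis_weight :: "nat \<Rightarrow> nat \<Rightarrow> heis set" where
  "heis_weight d m =
     heis_span {(\<Prod>(v, n)\<leftarrow>vs. mode d v n) | vs.
       (\<forall>(v, n) \<in> set vs. v \<in> carrier_vec d \<and> n \<ge> 1) \<and> (\<Sum>(v, n)\<leftarrow>vs. n) = m}"


section \<open>Orthogonal actions\<close>

definition orthogonal_group :: "nat \<Rightarrow> real mat monoid" where
  "orthogonal_group d =
     \<lparr>carrier = {A \<in> carrier_mat d d. transpose_mat A * A = 1\<^sub>m d}, mult = (*), one = 1\<^sub>m d\<rparr>"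

text \<open>The action of \<open>A \<in> O(d)\<close> on the Heisenberg VOA is the algebra endomorphism that sends
  \<open>(e\<^sub>i)\<^sub>-\<^sub>n\<close> to \<open>(A e\<^sub>i)\<^sub>-\<^sub>n\<close>. Lemma \<open>heis_act_monomial\<close> below gives its effect
  on the spanning vectors of \<open>heis_weight\<close>.\<close>

definition heis_act :: "nat \<Rightarrow> real mat \<Rightarrow> heis \<Rightarrow> heis" where
  "heis_act d A p =
     (\<Sum>t \<in> Poly_Mapping.keys p. heis_scale (Poly_Mapping.lookup p t)
        (\<Prod>(i, n) \<in> Poly_Mapping.keys t.
           mode d (map_mat complex_of_real A *\<^sub>v unit_vec d i) n ^ Poly_Mapping.lookup t (i, n)))"

text \<open>An orthogonal action of \<open>G\<close> is given by a homomorphism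
  \<open>\<rho> \<in> hom G (orthogonal_group d)\<close>.\<close>

definition heis_invariants ::
    "nat \<Rightarrow> nat \<Rightarrow> ('g, 'b) monoid_scheme \<Rightarrow> ('g \<Rightarrow> real mat) \<Rightarrow> heis set" where
  "heis_invariants d m G \<rho> = {p \<in> heis_weight d m. \<forall>g \<in> carrier G. heis_act d (\<rho> g) p = p}"


section \<open>Basic properties of these notions\<close>

lemma group_orthogonal_group: "group (orthogonal_group d)"
proof (rule groupI)
  fix A B assume "A \<in> carrier (orthogonal_group d)" "B \<in> carrier (orthogonal_group d)"
  then have A: "A \<in> carrier_mat d d" "transpose_mat A * A = 1\<^sub>m d"
    and B: "B \<in> carrier_mat d d" "transpose_mat B * B = 1\<^sub>m d"
    by (auto simp: orthogonal_group_def)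
  have "transpose_mat (A * B) * (A * B) = transpose_mat B * (transpose_mat A * (A * B))"
    using A(1) B(1) by (simp add: transpose_mult[of _ d d] assoc_mult_mat[of _ d d _ d _ d])
  also have "transpose_mat A * (A * B) = B"
    using A B(1) by (simp flip: assoc_mult_mat[of _ d d _ d _ d])
  finally show "A \<otimes>\<^bsub>orthogonal_group d\<^esub> B \<in> carrier (orthogonal_group d)"
    using A(1) B by (simp add: orthogonal_group_def)
next
  fix A assume "A \<in> carrier (orthogonal_group d)"
  then have A: "A \<in> carrier_mat d d" "transpose_mat A * A = 1\<^sub>m d"
    by (auto simp: orthogonal_group_def)
  then have "A * transpose_mat A = 1\<^sub>m d"
    by (intro mat_mult_left_right_inverse[of "transpose_mat A"]) auto
  with A show "\<exists>B \<in> carrier (orthogonal_group d). B \<otimes>\<^bsub>orthogonal_group d\<^esub> A = \<one>\<^bsub>orthogonal_group d\<^esub>"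
    by (intro bexI[of _ "transpose_mat A"]) (auto simp: orthogonal_group_def)
qed (auto simp: orthogonal_group_def assoc_mult_mat[of _ d d _ d _ d])

lemma heis_act_superset:
  assumes "finite T" "Poly_Mapping.keys p \<subseteq> T"
  shows "heis_act d A p =
    (\<Sum>t \<in> T. heis_scale (Poly_Mapping.lookup p t)
        (\<Prod>(i, n) \<in> Poly_Mapping.keys t.
           mode d (map_mat complex_of_real A *\<^sub>v unit_vec d i) n ^ Poly_Mapping.lookup t (i, n)))"
  unfolding heis_act_def using assms
  by (intro sum.mono_neutral_left) (auto simp: in_keys_iff)

lemma heis_act_add: "heis_act d A (p + q) = heis_act d A p + heis_act d A q"
proof -
  let ?T = "Poly_Mapping.keys p \<union> Poly_Mapping.keys q"
  have "Poly_Mapping.keys (p + q) \<subseteq> ?T"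
    by (rule keys_add)
  then show ?thesis
    by (simp add: heis_act_superset[of ?T] lookup_add heis.scale_left_distrib sum.distrib)
qed

lemma heis_act_0 [simp]: "heis_act d A 0 = 0"
  by (simp add: heis_act_def)

lemma heis_act_sum: "heis_act d A (\<Sum>x\<in>X. f x) = (\<Sum>x\<in>X. heis_act d A (f x))"
  by (induction X rule: infinite_finite_induct) (simp_all add: heis_act_add)

lemma heis_act_single:
  "heis_act d A (Poly_Mapping.single t c) = heis_scale c
     (\<Prod>(i, n) \<in> Poly_Mapping.keys t.
        mode d (map_mat complex_of_real A *\<^sub>v unit_vec d i) n ^ Poly_Mapping.lookup t (i, n))"
  by (subst heis_act_superset[of "{t}"]) auto

lemma poly_mapping_eq_sum_single:
  "p = (\<Sum>t\<in>Poly_Mapping.keys p. Poly_Mapping.single t (Poly_Mapping.lookup p t))"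
  by (rule poly_mapping_eqI)
    (auto simp: lookup_sum lookup_single when_def in_keys_iff)

lemma prod_keys_add:
  fixes f :: "'x \<Rightarrow> 'c::comm_monoid_mult" and s t :: "'x \<Rightarrow>\<^sub>0 nat"
  shows "(\<Prod>x\<in>Poly_Mapping.keys (s + t). f x ^ Poly_Mapping.lookup (s + t) x) =
    (\<Prod>x\<in>Poly_Mapping.keys s. f x ^ Poly_Mapping.lookup s x) *
    (\<Prod>x\<in>Poly_Mapping.keys t. f x ^ Poly_Mapping.lookup t x)"
proof -
  let ?T = "Poly_Mapping.keys s \<union> Poly_Mapping.keys t"
  have ext: "(\<Prod>x\<in>Poly_Mapping.keys u. f x ^ Poly_Mapping.lookup u x) =
      (\<Prod>x\<in>?T. f x ^ Poly_Mapping.lookup u x)" if "Poly_Mapping.keys u \<subseteq> ?T" for u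
    using that by (intro prod.mono_neutral_left) (auto simp: in_keys_iff)
  show ?thesis
    unfolding ext[OF keys_add] ext[OF Un_upper1] ext[OF Un_upper2]
    by (simp add: lookup_add power_add prod.distrib)
qed

lemma heis_act_single_mult:
  "heis_act d A (Poly_Mapping.single s a * Poly_Mapping.single t b) =
   heis_act d A (Poly_Mapping.single s a) * heis_act d A (Poly_Mapping.single t b)"
proof -
  have "heis_scale (a * b) (x * y) = heis_scale a x * heis_scale b y" for x y
    by (simp add: heis_scale_def mult_ac flip: mult_single[of 0 _ 0, simplified])
  then show ?thesis
    by (simp add: mult_single heis_act_single prod_keys_add split_beta)
qed

lemma heis_act_mult: "heis_act d A (p * q) = heis_act d A p * heis_act d A q"
proof -
  define P where "P = (\<lambda>t. Poly_Mapping.single t (Poly_Mapping.lookup p t))"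
  define Q where "Q = (\<lambda>t. Poly_Mapping.single t (Poly_Mapping.lookup q t))"
  have p: "p = sum P (Poly_Mapping.keys p)" and q: "q = sum Q (Poly_Mapping.keys q)"
    unfolding P_def Q_def by (rule poly_mapping_eq_sum_single)+
  have "heis_act d A (sum P X * sum Q Y) = heis_act d A (sum P X) * heis_act d A (sum Q Y)" for X Y
    by (simp add: sum_product heis_act_sum heis_act_single_mult P_def Q_def)
  then show ?thesis
    using p q by metis
qed

lemma heis_act_1 [simp]: "heis_act d A 1 = 1"
  using heis_act_single[of d A 0 1] by simp

lemma heis_act_scale: "heis_act d A (heis_scale c p) = heis_scale c (heis_act d A p)"
proof -
  have "heis_act d A (Poly_Mapping.single 0 c) = Poly_Mapping.single 0 c"
    by (simp add: heis_act_single heis_scale_def)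
  then show ?thesis
    by (simp add: heis_scale_def heis_act_mult)
qed

lemma heis_act_mode:
  assumes A: "A \<in> carrier_mat d d" and v: "v \<in> carrier_vec d"
  shows "heis_act d A (mode d v n) = mode d (map_mat complex_of_real A *\<^sub>v v) n"
proof -
  let ?A = "map_mat complex_of_real A"
  let ?X = "\<lambda>j. Poly_Mapping.single (Poly_Mapping.single (j, n) 1) 1 :: heis"
  have col: "(?A *\<^sub>v unit_vec d i) $ j = ?A $$ (j, i)" if "i < d" "j < d" for i j
    using A that by (simp add: scalar_prod_right_unit)
  have "heis_act d A (mode d v n) = (\<Sum>i<d. heis_scale (v $ i) (mode d (?A *\<^sub>v unit_vec d i) n))"
    by (simp add: mode_def[of d v] heis_act_sum heis_act_scale heis_act_single)
  also have "\<dots> = (\<Sum>i<d. \<Sum>j<d. heis_scale (?A $$ (j, i) * v $ i) (?X j))"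
    unfolding mode_def using col
    by (intro sum.cong) (auto simp: heis.scale_sum_right mult.commute)
  also have "\<dots> = (\<Sum>j<d. \<Sum>i<d. heis_scale (?A $$ (j, i) * v $ i) (?X j))"
    by (rule sum.swap)
  also have "\<dots> = (\<Sum>j<d. heis_scale ((?A *\<^sub>v v) $ j) (?X j))"
    using A v
    by (intro sum.cong refl)
      (auto simp: scalar_prod_def atLeast0LessThan simp flip: heis.scale_sum_left
        intro!: arg_cong2[where f = heis_scale] sum.cong)
  finally show ?thesis
    by (simp add: mode_def)
qed

lemma heis_act_monomial:
  assumes "A \<in> carrier_mat d d" and "\<forall>(v, n) \<in> set vs. v \<in> carrier_vec d"
  shows "heis_act d A (\<Prod>(v, n)\<leftarrow>vs. mode d v n) =
    (\<Prod>(v, n)\<leftarrow>vs. mode d (map_mat complex_of_real A *\<^sub>v v) n)"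
  using assms(2) by (induction vs) (auto simp: heis_act_mult heis_act_mode[OF assms(1)])

end

theory Submission
  imports Defs "HOL-Algebra.Multiplicative_Group" "HOL-Number_Theory.Cong"
begin

text \<open>Fourier projection along the cyclic subgroups of \<open>G\<close> shows that common eigenvectors \<open>u\<close>
  of \<open>G\<close> span \<open>E\<close>. Since \<open>G\<close> acts by real matrices with eigenvalues of modulus \<open>1\<close>, every
  \<open>q\<^sub>u = u\<^sub>-\<^sub>n \<bar>u\<bar>\<^sub>-\<^sub>1\<close> is invariant. Substituting \<open>z\<close> for the variables of mode \<open>n\<close> and
  \<open>\<bar>z\<bar>\<close> for those of mode \<open>1\<close> turns \<open>q\<^sub>u\<close> into \<open>\<bar>u \<bullet> z\<bar>\<^sup>2\<close>. If \<open>k\<close> of the \<open>q\<^sub>u\<close> span all of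
  them, then the \<open>k\<close> equations \<open>u \<bullet> z = 0\<close> force \<open>z = 0\<close>. For \<open>n \<ge> 2\<close> the vector \<open>z\<close> ranges
  over \<open>\<complex>\<^sup>d\<close>, so \<open>k \<ge> d\<close>; for \<open>n = 1\<close> it has to be real and each equation counts twice, so
  \<open>2 k \<ge> d\<close>.

  An even unimodular lattice has even rank, because its Gram matrix modulo \<open>2\<close> is that of a
  skew-symmetric matrix. Both bounds are attained by the cyclic group of order \<open>2 d + 2\<close> whose
  generator has the eigenvalues \<open>\<zeta>\<^sup>s\<close> with \<open>\<zeta> = exp (2 \<pi> \<i> / (2 d + 2))\<close> and
  \<open>s = 1 - d, 3 - d, \<dots>, d - 1\<close>: all \<open>s\<close> are odd, so that no product of one or three eigenvalues
  is \<open>1\<close>, and \<open>\<zeta>\<^sup>s \<zeta>\<^sup>s\<^sup>' = 1\<close> only if \<open>s' = - s\<close>.\<close>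

section \<open>Eigenvectors of finite abelian groups\<close>

lemma sum_powers_root_of_unity:
  fixes c :: "'a::field"
  assumes "c ^ N = 1" "c \<noteq> 1"
  shows "(\<Sum>k<N. c ^ k) = 0"
  using assms by (simp add: sum_gp_strict)

lemma (in vector_space) linear_funpow:
  "Vector_Spaces.linear scale scale f \<Longrightarrow> Vector_Spaces.linear scale scale (f ^^ k)"
  by (induction k) (auto simp: Vector_Spaces.linear_iff vector_space_axioms)

lemma (in vector_space) linear_sum_functions:
  assumes "\<And>k. k \<in> K \<Longrightarrow> Vector_Spaces.linear scale scale (f k)"
  shows "Vector_Spaces.linear scale scale (\<lambda>x. \<Sum>k\<in>K. f k x)"
  using assms by (simp add: Vector_Spaces.linear_iff vector_space_axioms sum.distrib scale_sum_right)

text \<open>The operator \<open>P\<close>, the sum of the powers of \<open>f\<close> below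
  \<open>N\<close>, multiplies a fixed vector by \<open>N\<close>, and it kills every
  \<open>b i\<close> with \<open>c i\<close> different from 1 because the geometric sum of a
  nontrivial root of unity vanishes. Applied to an expansion of \<open>p\<close>, it leaves only
  terms with eigenvalue 1. The family may be redundant, so it can consist of monomials indexed by
  ordered lists.\<close>

lemma (in vector_space) fixed_vector_in_span:
  assumes f: "Vector_Spaces.linear scale scale f"
    and eig: "\<And>i. i \<in> I \<Longrightarrow> f (b i) = scale (c i) (b i)"
    and root: "\<And>i. i \<in> I \<Longrightarrow> c i ^ N = 1"
    and N: "of_nat N \<noteq> (0::'a)"
    and p: "p \<in> span (b ` I)" "f p = p"
  shows "p \<in> span (b ` {i \<in> I. c i = 1})"
proof -
  define P where "P = (\<lambda>x. \<Sum>k<N. (f ^^ k) x)"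
  have linP: "Vector_Spaces.linear scale scale P"
    unfolding P_def by (intro linear_sum_functions linear_funpow f)
  have "P p \<in> span (b ` {i \<in> I. c i = 1})"
    using p(1)
  proof (induction rule: span_induct_alt)
    case base
    have "P 0 = 0" using linP by (simp add: linear_iff_module_hom module_hom.zero)
    then show ?case by (simp add: span_zero)
  next
    case (step r x y)
    then obtain i where i: "i \<in> I" "x = b i" by auto
    have "(f ^^ k) x = scale (c i ^ k) x" for k
    proof (induction k)
      case (Suc k)
      then show ?case using f eig[OF i(1)] by (simp add: Vector_Spaces.linear_iff i(2) mult.commute[of "c i"])
    qed simp
    then have Px: "P x = scale (\<Sum>k<N. c i ^ k) x"
      by (simp add: P_def scale_sum_left)
    have "P x \<in> span (b ` {i \<in> I. c i = 1})"
    proof (cases "c i = 1")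
      case True
      then show ?thesis using i unfolding Px by (intro span_scale span_base) auto
    next
      case False
      then show ?thesis using root[OF i(1)] by (simp add: Px sum_powers_root_of_unity span_zero)
    qed
    moreover have "P (scale r x + y) = scale r (P x) + P y"
      using linP by (simp add: Vector_Spaces.linear_iff)
    ultimately show ?case using step by (simp add: span_add span_scale)
  qed
  moreover have "(f ^^ k) p = p" for k
    by (induction k) (use p in auto)
  then have "P p = scale (of_nat N) p"
    by (simp add: P_def sum_constant_scale)
  ultimately have "scale (inverse (of_nat N)) (scale (of_nat N) p) \<in> span (b ` {i \<in> I. c i = 1})"
    by (metis span_scale)
  then show ?thesis using N by simp
qed

text \<open>Discrete Fourier transform along the orbit of \<open>w\<close>: \<open>P k\<close> is
  \<open>N\<close> times the component of \<open>w\<close> with eigenvalue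
  \<open>\<omega> ^ k\<close>.\<close>

lemma (in vector_space) eigenvector_decomposition:
  assumes f: "Vector_Spaces.linear scale scale f"
    and fw: "(f ^^ N) w = w"
    and root: "\<omega> ^ N = 1" "\<And>j. 0 < j \<Longrightarrow> j < N \<Longrightarrow> \<omega> ^ j \<noteq> 1"
  defines "P \<equiv> \<lambda>k. \<Sum>j<N. scale (inverse \<omega> ^ (k * j)) ((f ^^ j) w)"
  shows "f (P k) = scale (\<omega> ^ k) (P k)" "scale (of_nat N) w = (\<Sum>k<N. P k)"
proof -
  show "f (P k) = scale (\<omega> ^ k) (P k)"
  \<comment> \<open>For \<open>N = 0\<close> the sums are empty and \<open>\<omega>\<close> may be
    0; otherwise \<open>\<omega>\<close> is invertible.\<close>
  proof (cases "N = 0")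
    case True
    then show ?thesis using f by (simp add: P_def linear_iff_module_hom module_hom.zero)
  next
    case False
    then have w0: "\<omega> \<noteq> 0" using root(1) by (auto simp: power_0_left)
    define a where "a j = scale (inverse \<omega> ^ (k * j)) ((f ^^ j) w)" for j
    \<comment> \<open>The summand is periodic in \<open>j\<close> with period \<open>N\<close>, so
      the index shift caused by \<open>f\<close> only permutes the terms cyclically.\<close>
    have "a N = a 0"
      using fw root(1) by (simp add: a_def power_mult mult.commute[of k] power_inverse)
    have "f (P k) = (\<Sum>j<N. scale (inverse \<omega> ^ (k * j)) ((f ^^ Suc j) w))"
      using f by (simp add: P_def linear_iff_module_hom module_hom.sum module_hom.scale)
    also have "\<dots> = (\<Sum>j<N. scale (\<omega> ^ k) (a (Suc j)))"
      using w0 by (intro sum.cong) (simp_all add: a_def power_add power_inverse field_simps)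
    also have "\<dots> = scale (\<omega> ^ k) (\<Sum>j<N. a (Suc j))"
      by (simp add: scale_sum_right)
    also have "(\<Sum>j<N. a (Suc j)) = (\<Sum>j<N. a j)"
      using sum.lessThan_Suc_shift[of a N] sum.lessThan_Suc[of a N] \<open>a N = a 0\<close>
      by (simp add: add.commute)
    finally show ?thesis by (simp add: P_def a_def)
  qed
  have "(\<Sum>k<N. P k) = (\<Sum>j<N. \<Sum>k<N. scale (inverse \<omega> ^ (k * j)) ((f ^^ j) w))"
    unfolding P_def by (rule sum.swap)
  also have "\<dots> = (\<Sum>j<N. scale (\<Sum>k<N. (inverse \<omega> ^ j) ^ k) ((f ^^ j) w))"
    by (simp add: scale_sum_left mult.commute flip: power_mult)
  \<comment> \<open>Orthogonality of characters: the inner sum over \<open>k\<close> vanishes unless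
    \<open>j = 0\<close>.\<close>
  also have "\<dots> = (\<Sum>j<N. if j = 0 then scale (of_nat N) w else 0)"
  proof (intro sum.cong refl)
    fix j assume "j \<in> {..<N}"
    moreover have "(inverse \<omega> ^ j) ^ N = 1"
      using root(1) by (metis mult.commute power_mult power_inverse power_one inverse_1)
    moreover have "inverse \<omega> ^ j \<noteq> 1" if "0 < j" "j < N"
      using root(2)[OF that] by (simp add: power_inverse)
    ultimately show "scale (\<Sum>k<N. (inverse \<omega> ^ j) ^ k) ((f ^^ j) w) =
        (if j = 0 then scale (of_nat N) w else 0)"
      by (cases "j = 0") (auto simp: sum_powers_root_of_unity)
  qed
  also have "\<dots> = scale (of_nat N) w"
    by (cases N) (auto simp: sum.delta)
  finally show "scale (of_nat N) w = (\<Sum>k<N. P k)" ..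
qed

text \<open>The group elements are diagonalised one after another: the Fourier components along
  \<open>g\<close> of a common eigenvector for \<open>F\<close> remain eigenvectors for
  \<open>F\<close>, since the group is abelian. The action laws are demanded on \<open>W\<close>
  alone because in the application \<open>heis_act\<close> sends the variables with first index at
  least \<open>d\<close> to 0, so that even the identity matrix does not act as the identity on the
  whole type.\<close>

lemma (in vector_space) comm_group_common_eigenvectors_span:
  fixes G :: "('g, 'm) monoid_scheme"
  assumes G: "comm_group G" "finite (carrier G)"
    and lin: "\<And>g. g \<in> carrier G \<Longrightarrow> Vector_Spaces.linear scale scale (\<phi> g)"
    and W: "subspace W" "\<And>g w. g \<in> carrier G \<Longrightarrow> w \<in> W \<Longrightarrow> \<phi> g w \<in> W"
    and act: "\<And>g h w. g \<in> carrier G \<Longrightarrow> h \<in> carrier G \<Longrightarrow> w \<in> W \<Longrightarrow> \<phi> (g \<otimes>\<^bsub>G\<^esub> h) w = \<phi> g (\<phi> h w)"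
      "\<And>w. w \<in> W \<Longrightarrow> \<phi> \<one>\<^bsub>G\<^esub> w = w"
    and root: "(\<omega> :: 'a) ^ card (carrier G) = 1" "\<And>j. 0 < j \<Longrightarrow> j < card (carrier G) \<Longrightarrow> \<omega> ^ j \<noteq> 1"
    and char: "of_nat (card (carrier G)) \<noteq> (0::'a)"
  shows "W \<subseteq> span {w \<in> W. \<forall>g\<in>carrier G. \<exists>c. c ^ card (carrier G) = 1 \<and> \<phi> g w = scale c w}"
proof -
  interpret G: comm_group G by fact
  define S where "S F = {w \<in> W. \<forall>g\<in>F. \<exists>c. c ^ card (carrier G) = 1 \<and> \<phi> g w = scale c w}" for F
  have funpow_W: "(\<phi> g ^^ j) w \<in> W" if "g \<in> carrier G" "w \<in> W" for g j w
    by (induction j) (use that W(2) in auto)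
  have funpow: "(\<phi> g ^^ j) w = \<phi> (g [^]\<^bsub>G\<^esub> j) w" if "g \<in> carrier G" "w \<in> W" for g w and j :: nat
    by (induction j) (use that act G.nat_pow_Suc2 in auto)
  have comm: "\<phi> h ((\<phi> g ^^ j) w) = (\<phi> g ^^ j) (\<phi> h w)"
    if "g \<in> carrier G" "h \<in> carrier G" "w \<in> W" for g h j w
  proof (induction j)
    case (Suc j)
    have "\<phi> h (\<phi> g ((\<phi> g ^^ j) w)) = \<phi> g (\<phi> h ((\<phi> g ^^ j) w))"
      using that funpow_W by (metis act(1) G.m_comm)
    with Suc show ?case by simp
  qed simp
  have step: "S F \<subseteq> span (S (insert g F))" if F: "F \<subseteq> carrier G" and g: "g \<in> carrier G" for F g
  proof
    fix w assume w: "w \<in> S F"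
    then have wW: "w \<in> W" by (auto simp: S_def)
    define P where "P k = (\<Sum>j<card (carrier G). scale (inverse \<omega> ^ (k * j)) ((\<phi> g ^^ j) w))" for k
    have "(\<phi> g ^^ card (carrier G)) w = w"
      using g wW act(2) by (simp add: funpow G.pow_order_eq_1[unfolded Coset.order_def])
    then have dec: "\<phi> g (P k) = scale (\<omega> ^ k) (P k)"
      "scale (of_nat (card (carrier G))) w = (\<Sum>k<card (carrier G). P k)" for k
      unfolding P_def using root by (intro eigenvector_decomposition lin g; blast)+
    have "P k \<in> S (insert g F)" for k
      unfolding S_def
    proof (intro CollectI conjI ballI)
      show "P k \<in> W" unfolding P_def
        by (intro subspace_sum subspace_scale W(1) funpow_W g wW)
      fix h assume h: "h \<in> insert g F"
      show "\<exists>c. c ^ card (carrier G) = 1 \<and> \<phi> h (P k) = scale c (P k)"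
      proof (cases "h = g")
        case True
        have "(\<omega> ^ k) ^ card (carrier G) = 1"
          using root(1) by (metis mult.commute power_mult power_one)
        with dec(1) True show ?thesis by blast
      next
        case False
        then have hF: "h \<in> F" "h \<in> carrier G" using h F by auto
        then obtain c where c: "c ^ card (carrier G) = 1" "\<phi> h w = scale c w"
          using w by (auto simp: S_def)
        \<comment> \<open>As \<open>h\<close> commutes with the powers of \<open>g\<close>, it
          scales every summand by the same \<open>c\<close>.\<close>
        have "\<phi> h (P k) = (\<Sum>j<card (carrier G). scale (inverse \<omega> ^ (k * j)) (\<phi> h ((\<phi> g ^^ j) w)))"
          using lin[OF hF(2)] by (simp add: P_def linear_iff_module_hom module_hom.sum module_hom.scale)
        also have "\<dots> = (\<Sum>j<card (carrier G). scale (inverse \<omega> ^ (k * j)) (scale c ((\<phi> g ^^ j) w)))"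
          using linear_funpow[OF lin[OF g]]
          by (simp only: comm[OF g hF(2) wW] c(2)) (simp add: Vector_Spaces.linear_iff)
        also have "\<dots> = scale c (P k)"
          by (simp add: P_def scale_sum_right mult.commute)
        finally show ?thesis using c(1) by blast
      qed
    qed
    then have "scale (of_nat (card (carrier G))) w \<in> span (S (insert g F))"
      unfolding dec(2) by (blast intro: span_sum span_base)
    then have "scale (inverse (of_nat (card (carrier G)))) (scale (of_nat (card (carrier G))) w) \<in> span (S (insert g F))"
      by (rule span_scale)
    then show "w \<in> span (S (insert g F))" using char by simp
  qed
  have "W \<subseteq> span (S F)" if "finite F" "F \<subseteq> carrier G" for F
    using that
  proof (induction F rule: finite_induct)
    case empty
    show ?case using span_superset by (auto simp: S_def)
  next
    case (insert g F)
    then have "span (S F) \<subseteq> span (S (insert g F))"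
      by (intro span_minimal step) auto
    with insert show ?case by auto
  qed
  from this[OF G(2) order_refl] show ?thesis by (simp add: S_def)
qed

section \<open>Even rank\<close>

text \<open>Changing the signs below the diagonal and clearing the even diagonal does not alter
  \<open>M\<close> modulo 2, but makes it skew-symmetric. In odd size the new determinant is 0, so
  \<open>det M\<close> would be even, although it divides 1.\<close>

lemma even_rank_of_unimodular_even_gram:
  fixes M N :: "int mat"
  assumes M: "M \<in> carrier_mat d d" and N: "N \<in> carrier_mat d d" and MN: "M * N = 1\<^sub>m d"
    and sym: "transpose_mat M = M" and diag: "\<And>i. i < d \<Longrightarrow> even (M $$ (i, i))"
  shows "even d"
proof (rule ccontr)
  assume "odd d"
  define S where "S = mat d d (\<lambda>(i, j). if i < j then M $$ (i, j) else if i > j then - M $$ (i, j) else 0)"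
  have S: "S \<in> carrier_mat d d" by (simp add: S_def)
  have Msym: "M $$ (i, j) = M $$ (j, i)" if "i < d" "j < d" for i j
    using M that arg_cong[OF sym, of "\<lambda>A. A $$ (i, j)"] by simp
  have "transpose_mat S = (-1) \<cdot>\<^sub>m S"
    by (rule eq_matI) (auto simp: S_def Msym)
  then have "det S = (-1) ^ d * det S"
    using det_transpose[OF S] S by (metis carrier_matD(2) det_smult)
  then have "det S = 0" using \<open>odd d\<close> by simp
  have MS: "cong (M $$ (i, j)) (S $$ (i, j)) 2" if "i < d" "j < d" for i j
  proof -
    have "even (M $$ (i, j) - S $$ (i, j))"
      using that diag[of i] by (auto simp: S_def linorder_neq_iff)
    then show ?thesis by (simp add: cong_iff_dvd_diff)
  qed
  have "cong (det M) (det S) 2"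
    unfolding det_def'[OF M] det_def'[OF S]
    by (intro cong_sum cong_mult cong_prod cong_refl MS) (auto dest: permutes_in_image)
  with \<open>det S = 0\<close> have "even (det M)" by (simp add: cong_0_iff)
  moreover have "det M * det N = 1"
    using det_mult[OF M N] MN by simp
  ultimately show False by (metis dvd_mult2 odd_one)
qed

text \<open>The Gram matrix is integral with even diagonal. Self-duality makes it invertible over
  the integers: the dual basis lies in \<open>L\<close>, and its coordinates are the columns of the
  inverse.\<close>

lemma even_unimodular_lattice_even_rank:
  assumes "even_unimodular_lattice d L"
  shows "even d"
proof -
  from assms obtain B where B: "B \<in> carrier_mat d d" "det B \<noteq> 0"
      and L: "L = {B *\<^sub>v map_vec real_of_int z | z. z \<in> carrier_vec d}"
    and dual: "dual_lattice d L = L" and ev: "\<And>x. x \<in> L \<Longrightarrow> \<exists>k::int. x \<bullet> x = 2 * real_of_int k"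
    by (auto simp: even_unimodular_lattice_def is_lattice_def)
  define R where "R = transpose_mat B * B"
  have R: "R \<in> carrier_mat d d" using B by (simp add: R_def)
  have unit: "map_vec real_of_int (unit_vec d i) = unit_vec d i" for i
    by (rule eq_vecI) (auto simp: unit_vec_def)
  have colL: "col B i \<in> L" if "i < d" for i
  proof -
    have "B *\<^sub>v map_vec real_of_int (unit_vec d i) = col B i"
      unfolding unit using B that by (intro eq_vecI) (auto simp: scalar_prod_right_unit)
    then show ?thesis unfolding L by (auto intro!: exI[of _ "unit_vec d i"])
  qed
  have Rij: "R $$ (i, j) = col B i \<bullet> col B j" if "i < d" "j < d" for i j
    using that B by (simp add: R_def)
  have R_int: "R $$ (i, j) \<in> \<int>" if "i < d" "j < d" for i j
    using colL[OF that(1)] colL[OF that(2)] dual that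
    by (auto simp: Rij dual_lattice_def)
  \<comment> \<open>The entries of \<open>R\<close> are integers, so \<open>floor\<close> only
    changes their type.\<close>
  define M where "M = map_mat floor R"
  have M: "M \<in> carrier_mat d d" using R by (simp add: M_def)
  have MR: "map_mat real_of_int M = R"
    using R R_int by (intro eq_matI) (auto simp: M_def)
  have "\<exists>z. z \<in> carrier_vec d \<and> M *\<^sub>v z = unit_vec d j" if j: "j < d" for j
  proof -
    have BT: "transpose_mat B \<in> carrier_mat d d" "det (transpose_mat B) \<noteq> 0"
      using B by (auto simp: det_transpose)
    then obtain C where C: "C \<in> carrier_mat d d" "transpose_mat B * C = 1\<^sub>m d"
      using det_non_zero_imp_unit[OF BT, of "()"] by (auto simp: Units_def ring_mat_def)
    \<comment> \<open>The \<open>j\<close>-th dual basis vector: its inner product with column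
      \<open>i\<close> of \<open>B\<close> is 1 for \<open>i = j\<close> and 0 otherwise.\<close>
    define y where "y = C *\<^sub>v unit_vec d j"
    have y: "y \<in> carrier_vec d" using C by (simp add: y_def)
    have By: "transpose_mat B *\<^sub>v y = unit_vec d j"
      using C BT(1) unfolding y_def by (simp flip: assoc_mult_mat_vec[of _ d d])
    have "x \<bullet> y \<in> \<int>" if "x \<in> L" for x
    proof -
      from that obtain z where z: "z \<in> carrier_vec d" "x = B *\<^sub>v map_vec real_of_int z"
        by (auto simp: L)
      have "x \<bullet> y = map_vec real_of_int z \<bullet> (transpose_mat B *\<^sub>v y)"
        unfolding z(2) using B(1) z(1) y
        by (metis (no_types, lifting) map_carrier_vec transpose_vec_mult_scalar transpose_transpose transpose_carrier_mat)
      then show ?thesis using z(1) j by (simp add: By scalar_prod_right_unit)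
    qed
    then have "y \<in> L" using y dual by (auto simp: dual_lattice_def)
    then obtain z where z: "z \<in> carrier_vec d" "y = B *\<^sub>v map_vec real_of_int z"
      by (auto simp: L)
    have "map_vec real_of_int (M *\<^sub>v z) = R *\<^sub>v map_vec real_of_int z"
      using of_int_hom.mult_mat_vec_hom[OF M z(1)] MR by metis
    also have "\<dots> = transpose_mat B *\<^sub>v y"
      using B(1) z by (simp add: R_def assoc_mult_mat_vec[of _ d d _ d])
    finally have "map_vec real_of_int (M *\<^sub>v z) = map_vec real_of_int (unit_vec d j)"
      by (simp add: By unit)
    then show ?thesis using z(1) of_int_hom.vec_hom_inj by blast
  qed
  then obtain z where z: "\<And>j. j < d \<Longrightarrow> z j \<in> carrier_vec d" "\<And>j. j < d \<Longrightarrow> M *\<^sub>v z j = unit_vec d j"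
    by metis
  define N where "N = mat d d (\<lambda>(i, j). z j $ i)"
  have N: "N \<in> carrier_mat d d" by (simp add: N_def)
  have colN: "col N j = z j" if "j < d" for j
    using z(1)[OF that] that by (intro eq_vecI) (auto simp: N_def)
  have "M * N = 1\<^sub>m d"
  proof (rule eq_matI)
    fix i j assume ij: "i < dim_row (1\<^sub>m d :: int mat)" "j < dim_col (1\<^sub>m d :: int mat)"
    then have "(M * N) $$ (i, j) = (M *\<^sub>v z j) $ i" using M N by (simp add: colN)
    then show "(M * N) $$ (i, j) = 1\<^sub>m d $$ (i, j)" using ij z(2)[of j] by simp
  qed (use M N in auto)
  moreover have "transpose_mat M = M"
  proof (rule eq_matI)
    fix i j assume ij: "i < dim_row M" "j < dim_col M"
    then have "R $$ (i, j) = R $$ (j, i)"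
      using M B(1) by (simp add: Rij comm_scalar_prod[of _ d])
    then show "transpose_mat M $$ (i, j) = M $$ (i, j)" using ij M R by (simp add: M_def)
  qed (use M in auto)
  moreover have "even (M $$ (i, i))" if i: "i < d" for i
  proof -
    obtain k :: int where "R $$ (i, i) = 2 * real_of_int k"
      using ev[OF colL[OF i]] Rij[OF i i] by auto
    then have "R $$ (i, i) = real_of_int (2 * k)" by simp
    then have "M $$ (i, i) = 2 * k" using R i by (simp add: M_def del: of_int_mult)
    then show ?thesis by simp
  qed
  ultimately show ?thesis by (rule even_rank_of_unimodular_even_gram[OF M N])
qed

section \<open>Polynomials and modes\<close>

text \<open>Substitution of numbers for the variables. Being a ring homomorphism, it turns a linear
  relation between products of modes into one between products of inner products, which yields the
  lower bounds.\<close>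

definition heis_eval :: "(nat \<times> nat \<Rightarrow> complex) \<Rightarrow> heis \<Rightarrow> complex" where
  "heis_eval x p = (\<Sum>t\<in>Poly_Mapping.keys p. Poly_Mapping.lookup p t *
     (\<Prod>v\<in>Poly_Mapping.keys t. x v ^ Poly_Mapping.lookup t v))"

lemma heis_eval_superset:
  assumes "finite T" "Poly_Mapping.keys p \<subseteq> T"
  shows "heis_eval x p = (\<Sum>t\<in>T. Poly_Mapping.lookup p t *
     (\<Prod>v\<in>Poly_Mapping.keys t. x v ^ Poly_Mapping.lookup t v))"
  unfolding heis_eval_def using assms
  by (intro sum.mono_neutral_left) (auto simp: in_keys_iff)

lemma heis_eval_single:
  "heis_eval x (Poly_Mapping.single t c) =
     c * (\<Prod>v\<in>Poly_Mapping.keys t. x v ^ Poly_Mapping.lookup t v)"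
  by (subst heis_eval_superset[of "{t}"]) auto

lemma heis_eval_add: "heis_eval x (p + q) = heis_eval x p + heis_eval x q"
proof -
  let ?T = "Poly_Mapping.keys p \<union> Poly_Mapping.keys q"
  have "Poly_Mapping.keys (p + q) \<subseteq> ?T"
    by (rule keys_add)
  then show ?thesis
    by (simp add: heis_eval_superset[of ?T] lookup_add distrib_right sum.distrib)
qed

lemma heis_eval_0 [simp]: "heis_eval x 0 = 0"
  by (simp add: heis_eval_def)

lemma heis_eval_sum: "heis_eval x (\<Sum>i\<in>I. f i) = (\<Sum>i\<in>I. heis_eval x (f i))"
  by (induction I rule: infinite_finite_induct) (simp_all add: heis_eval_add)

lemma heis_eval_mult: "heis_eval x (p * q) = heis_eval x p * heis_eval x q"
proof -
  define P where "P = (\<lambda>t. Poly_Mapping.single t (Poly_Mapping.lookup p t))"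
  define Q where "Q = (\<lambda>t. Poly_Mapping.single t (Poly_Mapping.lookup q t))"
  have p: "p = sum P (Poly_Mapping.keys p)" and q: "q = sum Q (Poly_Mapping.keys q)"
    unfolding P_def Q_def by (rule poly_mapping_eq_sum_single)+
  have "heis_eval x (sum P X * sum Q Y) = heis_eval x (sum P X) * heis_eval x (sum Q Y)" for X Y
    by (simp add: sum_product heis_eval_sum P_def Q_def mult_single heis_eval_single prod_keys_add mult_ac)
  then show ?thesis
    using p q by metis
qed

lemma heis_eval_scale: "heis_eval x (heis_scale c p) = c * heis_eval x p"
  by (simp add: heis_scale_def heis_eval_mult heis_eval_single)

lemma heis_eval_mode: "heis_eval x (mode d v n) = (\<Sum>i<d. v $ i * x (i, n))"
  by (simp add: mode_def heis_eval_sum heis_eval_scale heis_eval_single)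

lemma heis_eval_span_eq_0:
  assumes "p \<in> heis_span S" "\<And>q. q \<in> S \<Longrightarrow> heis_eval x q = 0"
  shows "heis_eval x p = 0"
  using assms(1)
  by (induction rule: heis.span_induct_alt) (simp_all add: assms(2) heis_eval_add heis_eval_scale)

section \<open>Spanning sets of the weight spaces\<close>

lemma heis_span_mult:
  assumes "p \<in> heis_span S" "q \<in> heis_span T"
  shows "p * q \<in> heis_span {s * t | s t. s \<in> S \<and> t \<in> T}"
  using assms(1)
proof (induction rule: heis.span_induct_alt)
  case base
  show ?case by (simp add: heis.span_zero)
next
  case (step c s p)
  have "s * q \<in> heis_span {s * t | s t. s \<in> S \<and> t \<in> T}"
    using assms(2)
  proof (induction rule: heis.span_induct_alt)
    case base
    show ?case by (simp add: heis.span_zero)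
  next
    case (step c' t q)
    have "s * (heis_scale c' t + q) = heis_scale c' (s * t) + s * q"
      by (simp add: heis_scale_def algebra_simps)
    moreover have "s * t \<in> heis_span {s * t | s t. s \<in> S \<and> t \<in> T}"
      using step(1) \<open>s \<in> S\<close> by (intro heis.span_base) auto
    ultimately show ?case using step by (simp add: heis.span_add heis.span_scale)
  qed
  moreover have "(heis_scale c s + p) * q = heis_scale c (s * q) + p * q"
    by (simp add: heis_scale_def algebra_simps)
  ultimately show ?case using step by (simp add: heis.span_add heis.span_scale)
qed

text \<open>Multilinear expansion of each monomial. It serves with unit vectors, to prove finite
  dimension, and with eigenvectors of the rotation, to find the invariants.\<close>

lemma heis_weight_subset_span:
  assumes w: "\<And>v n. v \<in> carrier_vec d \<Longrightarrow> mode d v n \<in> heis_span ((\<lambda>i. w i n) ` {..<d})"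
  shows "heis_weight d m \<subseteq> heis_span ((\<lambda>ts. \<Prod>(i, n)\<leftarrow>ts. w i n) `
    {ts. set ts \<subseteq> {..<d} \<times> {1..} \<and> (\<Sum>(i, n)\<leftarrow>ts. n) = m})"
proof -
  \<comment> \<open>The sequence \<open>ns\<close> of mode numbers is kept fixed: expanding the
    factors does not touch it, so positivity and total weight carry over.\<close>
  define M where "M ns = (\<lambda>ts. \<Prod>(i, n)\<leftarrow>ts. w i n) ` {ts. set (map fst ts) \<subseteq> {..<d} \<and> map snd ts = ns}"
    for ns
  have M: "(\<Prod>(v, n)\<leftarrow>vs. mode d v n) \<in> heis_span (M (map snd vs))"
    if "\<forall>(v, n) \<in> set vs. v \<in> carrier_vec d" for vs
    using that
  proof (induction vs)
    case Nil
    have "1 \<in> M []" unfolding M_def by (intro image_eqI[of _ _ "[]"]) auto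
    then show ?case by (simp add: heis.span_base)
  next
    case (Cons a vs)
    obtain v n where a: "a = (v, n)" by (cases a)
    have "{s * t | s t. s \<in> (\<lambda>i. w i n) ` {..<d} \<and> t \<in> M (map snd vs)} \<subseteq> M (map snd (a # vs))"
    proof clarify
      fix i t assume "i < d" "t \<in> M (map snd vs)"
      then obtain ts where "t = (\<Prod>(i, n)\<leftarrow>ts. w i n)" "set (map fst ts) \<subseteq> {..<d}" "map snd ts = map snd vs"
        by (auto simp: M_def)
      with \<open>i < d\<close> show "w i n * t \<in> M (map snd (a # vs))"
        unfolding M_def a by (intro image_eqI[of _ _ "(i, n) # ts"]) auto
    qed
    moreover have "mode d v n * (\<Prod>(v, n)\<leftarrow>vs. mode d v n) \<in>
        heis_span {s * t | s t. s \<in> (\<lambda>i. w i n) ` {..<d} \<and> t \<in> M (map snd vs)}"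
      using Cons by (intro heis_span_mult w) (auto simp: a)
    ultimately have "mode d v n * (\<Prod>(v, n)\<leftarrow>vs. mode d v n) \<in> heis_span (M (map snd (a # vs)))"
      using heis.span_mono by blast
    then show ?case by (simp add: a)
  qed
  have "(\<Prod>(v, n)\<leftarrow>vs. mode d v n) \<in> heis_span ((\<lambda>ts. \<Prod>(i, n)\<leftarrow>ts. w i n) `
      {ts. set ts \<subseteq> {..<d} \<times> {1..} \<and> (\<Sum>(i, n)\<leftarrow>ts. n) = m})"
    if vs: "\<forall>(v, n) \<in> set vs. v \<in> carrier_vec d \<and> n \<ge> 1" "(\<Sum>(v, n)\<leftarrow>vs. n) = m" for vs
  proof -
    have sum: "sum_list (map snd vs) = m" using vs(2) by (simp add: case_prod_beta')
    have pos: "\<forall>n\<in>set (map snd vs). n \<ge> 1" using vs(1) by auto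
    have "M (map snd vs) \<subseteq> (\<lambda>ts. \<Prod>(i, n)\<leftarrow>ts. w i n) `
      {ts. set ts \<subseteq> {..<d} \<times> {1..} \<and> (\<Sum>(i, n)\<leftarrow>ts. n) = m}"
      unfolding M_def
    proof (intro image_mono subsetI CollectI conjI)
      fix ts assume "ts \<in> {ts. set (map fst ts) \<subseteq> {..<d} \<and> map snd ts = map snd vs}"
      then have ts: "fst ` set ts \<subseteq> {..<d}" "map snd ts = map snd vs" by auto
      then have "\<forall>n\<in>snd ` set ts. n \<ge> 1" using pos by (metis set_map)
      with ts(1) show "x \<in> {..<d} \<times> {1..}" if "x \<in> set ts" for x
        using that by (cases x) force
      show "(\<Sum>(i, n)\<leftarrow>ts. n) = m" using ts(2) sum by (simp add: case_prod_beta')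
    qed
    moreover have "(\<Prod>(v, n)\<leftarrow>vs. mode d v n) \<in> heis_span (M (map snd vs))"
      using vs(1) by (intro M) auto
    ultimately show ?thesis using heis.span_mono by blast
  qed
  then show ?thesis
    unfolding heis_weight_def by (intro heis.span_minimal) auto
qed

lemma mode_eq_sum_unit_modes:
  "mode d v n = (\<Sum>i<d. heis_scale (v $ i) (mode d (unit_vec d i) n))"
proof -
  have "mode d (unit_vec d i) n = Poly_Mapping.single (Poly_Mapping.single (i, n) 1) 1" if "i < d" for i
  proof -
    have "mode d (unit_vec d i) n =
        (\<Sum>j<d. if j = i then Poly_Mapping.single (Poly_Mapping.single (j, n) 1) 1 else 0)"
      unfolding mode_def using that by (intro sum.cong) (auto simp: unit_vec_def)
    then show ?thesis using that by simp
  qed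
  then show ?thesis unfolding mode_def[of d v] by (intro sum.cong) auto
qed

text \<open>Since all parts are positive, the lengths and the entries of the index lists are bounded
  by \<open>m\<close>. Finiteness makes \<open>heis_dim\<close> comparable with the sizes of
  independent sets.\<close>

lemma heis_weight_finite_dim:
  obtains T where "finite T" "heis_weight d m \<subseteq> heis_span T"
proof
  let ?I = "{ts. set ts \<subseteq> {..<d} \<times> {1..} \<and> (\<Sum>(i, n)\<leftarrow>ts. n) = m}"
  have "?I \<subseteq> {ts. set ts \<subseteq> {..<d} \<times> {..m} \<and> length ts \<le> m}"
  proof safe
    fix ts :: "(nat \<times> nat) list" assume ts: "set ts \<subseteq> {..<d} \<times> {1..}"
    have "length ts \<le> (\<Sum>(i, n)\<leftarrow>ts. n)"
      using ts by (induction ts) auto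
    then show "length ts \<le> (\<Sum>(i, n)\<leftarrow>ts. n)" .
    fix i n assume "(i, n) \<in> set ts"
    then show "i < d" using ts by auto
    from \<open>(i, n) \<in> set ts\<close> have "n \<in> set (map snd ts)" by force
    then show "n \<le> (\<Sum>(i, n)\<leftarrow>ts. n)"
      using member_le_sum_list[of n "map snd ts"] by (simp add: case_prod_beta')
  qed
  moreover have "finite {ts. set ts \<subseteq> {..<d} \<times> {..m} \<and> length ts \<le> m}"
    by (intro finite_lists_length_le) auto
  ultimately show "finite ((\<lambda>ts. \<Prod>(i, n)\<leftarrow>ts. mode d (unit_vec d i) n) ` ?I)"
    using finite_subset by blast
  show "heis_weight d m \<subseteq> heis_span ((\<lambda>ts. \<Prod>(i, n)\<leftarrow>ts. mode d (unit_vec d i) n) ` ?I)"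
  proof (rule heis_weight_subset_span)
    fix v n
    show "mode d v n \<in> heis_span ((\<lambda>i. mode d (unit_vec d i) n) ` {..<d})"
      by (subst mode_eq_sum_unit_modes)
        (rule heis.span_sum, rule heis.span_scale, rule heis.span_base, rule imageI)
  qed
qed

lemma linear_heis_act: "Vector_Spaces.linear heis_scale heis_scale (heis_act d A)"
  by (simp add: Vector_Spaces.linear_iff heis_act_add heis_act_scale heis.vector_space_axioms)

section \<open>Lower bounds\<close>

lemma lookup_mode:
  assumes "i < d"
  shows "Poly_Mapping.lookup (mode d v n) (Poly_Mapping.single (i, n) 1) = v $ i"
proof -
  have single_eq: "Poly_Mapping.single (j, n) (1::nat) = Poly_Mapping.single (i, n) 1 \<longleftrightarrow> j = i" for j
    by (metis lookup_single_eq lookup_single_not_eq old.prod.inject zero_neq_one)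
  have "Poly_Mapping.lookup (mode d v n) (Poly_Mapping.single (i, n) 1) =
      (\<Sum>j<d. if j = i then v $ j else 0)"
    unfolding mode_def lookup_sum
    by (intro sum.cong) (auto simp: heis_scale_def mult_single lookup_single single_eq when_def
      simp del: One_nat_def)
  then show ?thesis using assms by simp
qed

lemma mode_inj:
  assumes "mode d u n = mode d v n" "u \<in> carrier_vec d" "v \<in> carrier_vec d"
  shows "u = v"
proof (rule eq_vecI)
  fix i assume "i < dim_vec v"
  then have "i < d" using assms(3) by simp
  then show "u $ i = v $ i" using assms(1) by (metis lookup_mode)
qed (use assms in auto)

lemma mode_add: "u \<in> carrier_vec d \<Longrightarrow> v \<in> carrier_vec d \<Longrightarrow> mode d (u + v) n = mode d u n + mode d v n"
  by (simp add: mode_def heis.scale_left_distrib sum.distrib)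

lemma mode_smult: "v \<in> carrier_vec d \<Longrightarrow> mode d (c \<cdot>\<^sub>v v) n = heis_scale c (mode d v n)"
  by (simp add: mode_def heis.scale_sum_right)

lemma subspace_modes: "heis.subspace ((\<lambda>v. mode d v n) ` carrier_vec d)"
proof (rule heis.subspaceI)
  show "0 \<in> (\<lambda>v. mode d v n) ` carrier_vec d"
    by (intro image_eqI[of _ _ "0\<^sub>v d"]) (auto simp: mode_def)
next
  fix p q assume "p \<in> (\<lambda>v. mode d v n) ` carrier_vec d" "q \<in> (\<lambda>v. mode d v n) ` carrier_vec d"
  then show "p + q \<in> (\<lambda>v. mode d v n) ` carrier_vec d"
    by (auto simp flip: mode_add)
next
  fix c p assume "p \<in> (\<lambda>v. mode d v n) ` carrier_vec d"
  then show "heis_scale c p \<in> (\<lambda>v. mode d v n) ` carrier_vec d"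
    by (auto simp flip: mode_smult)
qed

section \<open>Common eigenvectors and the invariants made from them\<close>

text \<open>The eigenvalues enter later through \<open>c * cnj c = 1\<close>, hence the condition on
  the modulus instead of the order.\<close>

definition unitary_eigenvectors :: "nat \<Rightarrow> ('g, 'b) monoid_scheme \<Rightarrow> ('g \<Rightarrow> real mat) \<Rightarrow> complex vec set" where
  "unitary_eigenvectors d G \<rho> = {u \<in> carrier_vec d. \<forall>g\<in>carrier G.
     \<exists>c. cmod c = 1 \<and> map_mat complex_of_real (\<rho> g) *\<^sub>v u = c \<cdot>\<^sub>v u}"

lemma cis_eq_1_imp_dvd:
  assumes "cis (2 * pi * real_of_int s / real N) = 1" "N > 0"
  shows "int N dvd s"
proof -
  have "cos (2 * pi * real_of_int s / real N) = 1"
    using assms(1) by (metis cis.sel(1) one_complex.sel(1))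
  then obtain m :: int where "2 * pi * real_of_int s / real N = real_of_int m * 2 * pi"
    by (auto simp: cos_one_2pi_int)
  then have "real_of_int s = real_of_int m * real N" using assms(2) by (simp add: field_simps)
  then have "s = m * int N" by (metis of_int_eq_iff of_int_mult of_int_of_nat_eq)
  then show ?thesis by simp
qed

lemma primitive_root_of_unity_cis:
  assumes "N > 0"
  shows "cis (2 * pi / real N) ^ N = 1"
    and "0 < j \<Longrightarrow> j < N \<Longrightarrow> cis (2 * pi / real N) ^ j \<noteq> 1"
proof -
  show "cis (2 * pi / real N) ^ N = 1" using assms by (simp add: DeMoivre)
  assume j: "0 < j" "j < N"
  then have "\<not> int N dvd int j" by (auto dest: dvd_imp_le)
  moreover have "cis (2 * pi / real N) ^ j = cis (2 * pi * real_of_int (int j) / real N)"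
    by (simp add: DeMoivre mult_ac)
  ultimately show "cis (2 * pi / real N) ^ j \<noteq> 1"
    using cis_eq_1_imp_dvd[of "int j" N] assms by auto
qed

lemma orthogonal_hom_carrier:
  "\<rho> \<in> hom G (orthogonal_group d) \<Longrightarrow> g \<in> carrier G \<Longrightarrow> \<rho> g \<in> carrier_mat d d"
  by (auto simp: hom_def orthogonal_group_def)

text \<open>The decomposition is carried out on the modes and not on E itself: \<open>heis\<close>
  is a vector space as a type, while \<open>complex vec\<close> contains vectors of all dimensions.
  Injectivity of \<open>mode\<close> brings the eigenvector equations back to E.\<close>

lemma unitary_eigenvectors_span:
  fixes G :: "('g, 'b) monoid_scheme"
  assumes G: "comm_group G" "finite (carrier G)" and \<rho>: "\<rho> \<in> hom G (orthogonal_group d)"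
  shows "(\<lambda>v. mode d v n) ` carrier_vec d \<subseteq> heis_span ((\<lambda>v. mode d v n) ` unitary_eigenvectors d G \<rho>)"
    (is "?W \<subseteq> _")
proof -
  interpret G: comm_group G by fact
  let ?A = "\<lambda>g. map_mat complex_of_real (\<rho> g)"
  let ?N = "card (carrier G)"
  have A: "?A g \<in> carrier_mat d d" if "g \<in> carrier G" for g
    using orthogonal_hom_carrier[OF \<rho> that] by simp
  have act: "heis_act d (\<rho> g) (mode d v n) = mode d (?A g *\<^sub>v v) n"
    if "g \<in> carrier G" "v \<in> carrier_vec d" for g v
    using that orthogonal_hom_carrier[OF \<rho>] by (simp add: heis_act_mode)
  have one: "\<rho> \<one>\<^bsub>G\<^esub> = 1\<^sub>m d"
    using hom_one[OF \<rho> G.is_group group_orthogonal_group] by (simp add: orthogonal_group_def)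
  have mult: "?A (g \<otimes>\<^bsub>G\<^esub> h) = ?A g * ?A h" if "g \<in> carrier G" "h \<in> carrier G" for g h
  proof -
    have "\<rho> (g \<otimes>\<^bsub>G\<^esub> h) = \<rho> g * \<rho> h"
      using hom_mult[OF \<rho> that] by (simp add: orthogonal_group_def)
    then show ?thesis
      using that orthogonal_hom_carrier[OF \<rho>] by (metis of_real_hom.mat_hom_mult)
  qed
  have N: "?N > 0" using G(2) G.one_closed by (auto simp: card_gt_0_iff)
  have "?W \<subseteq> heis_span {w \<in> ?W. \<forall>g\<in>carrier G. \<exists>c. c ^ ?N = 1 \<and> heis_act d (\<rho> g) w = heis_scale c w}"
  proof (rule heis.comm_group_common_eigenvectors_span[OF G linear_heis_act subspace_modes])
    fix g w assume "g \<in> carrier G" "w \<in> ?W"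
    then show "heis_act d (\<rho> g) w \<in> ?W"
      by (auto simp: act intro!: imageI mult_mat_vec_carrier A)
  next
    fix g h w assume gh: "g \<in> carrier G" "h \<in> carrier G" and "w \<in> ?W"
    then obtain v where v: "v \<in> carrier_vec d" "w = mode d v n" by auto
    have "?A h *\<^sub>v v \<in> carrier_vec d" using A[OF gh(2)] v(1) by simp
    then show "heis_act d (\<rho> (g \<otimes>\<^bsub>G\<^esub> h)) w = heis_act d (\<rho> g) (heis_act d (\<rho> h) w)"
      using gh v by (simp add: act mult[OF gh] assoc_mult_mat_vec[OF A A])
  next
    fix w assume "w \<in> ?W"
    then show "heis_act d (\<rho> \<one>\<^bsub>G\<^esub>) w = w"
      using act[OF G.one_closed] by (auto simp: one of_real_hom.mat_hom_one)
  qed (use primitive_root_of_unity_cis[OF N] N in auto)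
  moreover have "{w \<in> ?W. \<forall>g\<in>carrier G. \<exists>c. c ^ ?N = 1 \<and> heis_act d (\<rho> g) w = heis_scale c w}
      \<subseteq> (\<lambda>v. mode d v n) ` unitary_eigenvectors d G \<rho>"
  proof clarify
    fix v :: "complex vec"
    assume v: "v \<in> carrier_vec d"
      and eig: "\<forall>g\<in>carrier G. \<exists>c. c ^ ?N = 1 \<and> heis_act d (\<rho> g) (mode d v n) = heis_scale c (mode d v n)"
    have "\<exists>c. cmod c = 1 \<and> ?A g *\<^sub>v v = c \<cdot>\<^sub>v v" if g: "g \<in> carrier G" for g
    proof -
      obtain c where c: "c ^ ?N = 1" "heis_act d (\<rho> g) (mode d v n) = heis_scale c (mode d v n)"
        using eig g by blast
      have "mode d (?A g *\<^sub>v v) n = mode d (c \<cdot>\<^sub>v v) n"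
        using c(2) by (simp only: act[OF g v] mode_smult[OF v])
      then have "?A g *\<^sub>v v = c \<cdot>\<^sub>v v"
        using A[OF g] v by (intro mode_inj) auto
      moreover have "cmod c = 1" using power_eq_1_iff[OF c(1)] N by simp
      ultimately show ?thesis by blast
    qed
    with v show "mode d v n \<in> (\<lambda>v. mode d v n) ` unitary_eigenvectors d G \<rho>"
      by (auto simp: unitary_eigenvectors_def)
  qed
  ultimately show ?thesis using heis.span_mono by blast
qed

text \<open>A real matrix commutes with complex conjugation, so the conjugate of \<open>u\<close> is
  an eigenvector for \<open>cnj c\<close>, and the product is scaled by
  \<open>c * cnj c = 1\<close>.\<close>

lemma conj_product_invariant:
  assumes \<rho>: "\<rho> \<in> hom G (orthogonal_group d)" and u: "u \<in> unitary_eigenvectors d G \<rho>" and n: "n \<ge> 1"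
  shows "mode d u n * mode d (map_vec cnj u) 1 \<in> heis_invariants d (Suc n) G \<rho>"
proof -
  have uc: "u \<in> carrier_vec d" using u by (simp add: unitary_eigenvectors_def)
  have "mode d u n * mode d (map_vec cnj u) 1 \<in> heis_weight d (Suc n)"
    unfolding heis_weight_def
    using n uc by (intro heis.span_base CollectI exI[of _ "[(u, n), (map_vec cnj u, 1)]"]) auto
  moreover have "heis_act d (\<rho> g) (mode d u n * mode d (map_vec cnj u) 1) =
      mode d u n * mode d (map_vec cnj u) 1" if g: "g \<in> carrier G" for g
  proof -
    let ?A = "map_mat complex_of_real (\<rho> g)"
    have A: "?A \<in> carrier_mat d d" using orthogonal_hom_carrier[OF \<rho> g] by simp
    obtain c where c: "cmod c = 1" "?A *\<^sub>v u = c \<cdot>\<^sub>v u"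
      using u g by (auto simp: unitary_eigenvectors_def)
    have "?A *\<^sub>v map_vec cnj u = map_vec cnj (?A *\<^sub>v u)"
      using A uc by (intro eq_vecI) (auto simp: scalar_prod_def)
    then have cc: "?A *\<^sub>v map_vec cnj u = cnj c \<cdot>\<^sub>v map_vec cnj u"
      unfolding c(2) using uc by (intro eq_vecI) auto
    have "heis_act d (\<rho> g) (mode d u n * mode d (map_vec cnj u) 1) =
        heis_scale c (mode d u n) * heis_scale (cnj c) (mode d (map_vec cnj u) 1)"
      using uc orthogonal_hom_carrier[OF \<rho> g]
      by (simp add: heis_act_mult heis_act_mode c(2) cc mode_smult)
    also have "\<dots> = heis_scale (c * cnj c) (mode d u n * mode d (map_vec cnj u) 1)"
      by (simp add: heis_scale_def mult_ac flip: mult_single[of 0 _ 0, simplified])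
    also have "c * cnj c = 1" using complex_norm_square[of c] c(1) by simp
    finally show ?thesis by simp
  qed
  ultimately show ?thesis by (simp add: heis_invariants_def)
qed

section \<open>Counting linear equations\<close>

lemma homogeneous_system_nonzero_solution:
  fixes C :: "'a::field vec set"
  assumes "finite C" "C \<subseteq> carrier_vec d" "card C < d"
  obtains z where "z \<in> carrier_vec d" "z \<noteq> 0\<^sub>v d" "\<And>c. c \<in> C \<Longrightarrow> c \<bullet> z = 0"
proof -
  obtain cs where cs: "set cs = C" "length cs = card C"
    using assms(1) finite_distinct_list distinct_card by metis
  \<comment> \<open>The system is padded with zero rows to a square matrix. As there are fewer than
    \<open>d\<close> equations, the last row is zero, so the transpose kills the last unit vector
    and the determinant vanishes.\<close>
  define A where "A = mat d d (\<lambda>(i, j). if i < length cs then cs ! i $ j else 0)"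
  have A: "A \<in> carrier_mat d d" "transpose_mat A \<in> carrier_mat d d" by (simp_all add: A_def)
  let ?e = "unit_vec d (d - 1) :: 'a vec"
  have "transpose_mat A *\<^sub>v ?e = 0\<^sub>v d"
    using assms(3) cs(2) by (intro eq_vecI) (auto simp: A_def scalar_prod_right_unit)
  moreover have "?e \<noteq> 0\<^sub>v d" "?e \<in> carrier_vec d"
    using assms(3) by (auto simp: unit_vec_nonzero)
  ultimately have "det (transpose_mat A) = 0"
    using A by (subst det_0_iff_vec_prod_zero[of _ d]) blast+
  then have "det A = 0" using A by (simp add: det_transpose)
  then obtain z where z: "z \<in> carrier_vec d" "z \<noteq> 0\<^sub>v d" "A *\<^sub>v z = 0\<^sub>v d"
    using det_0_iff_vec_prod_zero[OF A(1)] by auto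
  have "c \<bullet> z = 0" if c: "c \<in> C" for c
  proof -
    obtain i where i: "i < length cs" "c = cs ! i" using c cs(1) by (metis in_set_conv_nth)
    have "c \<in> carrier_vec d" using c assms(2) by auto
    then have "row A i = c"
      using i assms(3) cs(2) by (intro eq_vecI) (auto simp: A_def)
    moreover have "(A *\<^sub>v z) $ i = row A i \<bullet> z"
      using i assms(3) cs(2) A by simp
    ultimately show ?thesis using z(3) i assms(3) cs(2) by simp
  qed
  with z show ?thesis using that by blast
qed

text \<open>The set \<open>C\<close> holds one eigenvector for each member of a maximal independent
  set of the products \<open>q u\<close>. If all its members annihilate \<open>z\<close>, evaluation
  shows that every common eigenvector does, and these span E. For \<open>n = 1\<close> both factors
  use the same variables, so values \<open>z\<close> and \<open>cnj z\<close> are compatible only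
  when \<open>z\<close> is real.\<close>

lemma heis_invariants_separating_vectors:
  fixes G :: "('g, 'b) monoid_scheme"
  assumes G: "comm_group G" "finite (carrier G)" and \<rho>: "\<rho> \<in> hom G (orthogonal_group d)" and n: "n \<ge> 1"
  obtains C where "finite C" "C \<subseteq> carrier_vec d" "card C \<le> heis_dim (heis_invariants d (Suc n) G \<rho>)"
    "\<forall>z\<in>carrier_vec d. (n = 1 \<longrightarrow> (\<forall>i<d. cnj (z $ i) = z $ i)) \<longrightarrow>
      (\<forall>c\<in>C. c \<bullet> z = 0) \<longrightarrow> z = 0\<^sub>v d"
proof -
  let ?V = "heis_invariants d (Suc n) G \<rho>"
  let ?U = "unitary_eigenvectors d G \<rho>"
  define q where "q u = mode d u n * mode d (map_vec cnj u) 1" for u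
  have qV: "q ` ?U \<subseteq> ?V" using conj_product_invariant[OF \<rho> _ n] by (auto simp: q_def)
  have U: "?U \<subseteq> carrier_vec d" by (auto simp: unitary_eigenvectors_def)
  obtain T where T: "finite T" "heis_weight d (Suc n) \<subseteq> heis_span T" by (rule heis_weight_finite_dim)
  then have VT: "?V \<subseteq> heis_span T" by (auto simp: heis_invariants_def)
  obtain B where B: "B \<subseteq> ?V" "heis.independent B" "?V \<subseteq> heis_span B" "card B = heis_dim ?V"
    using heis.basis_exists by blast
  have "finite B" using heis.independent_span_bound[OF T(1) B(2)] B(1) VT by blast
  obtain I where I: "I \<subseteq> q ` ?U" "heis.independent I" "q ` ?U \<subseteq> heis_span I"
    using heis.maximal_independent_subset by blast
  have "finite I \<and> card I \<le> card B"
    using I(1) qV B(3) by (intro heis.independent_span_bound \<open>finite B\<close> I(2)) blast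
  obtain C where C: "C \<subseteq> ?U" "I = q ` C" "inj_on q C" using I(1) by (meson subset_image_inj)
  show thesis
  proof (rule that)
    show "finite C" using C \<open>finite I \<and> card I \<le> card B\<close> by (metis finite_imageD)
    show "C \<subseteq> carrier_vec d" using C U by auto
    show "card C \<le> heis_dim ?V" using \<open>finite I \<and> card I \<le> card B\<close> C card_image B(4) by metis
    show "\<forall>z\<in>carrier_vec d. (n = 1 \<longrightarrow> (\<forall>i<d. cnj (z $ i) = z $ i)) \<longrightarrow>
      (\<forall>c\<in>C. c \<bullet> z = 0) \<longrightarrow> z = 0\<^sub>v d"
    proof (intro ballI impI)
      fix z assume z: "z \<in> carrier_vec d" and real: "n = 1 \<longrightarrow> (\<forall>i<d. cnj (z $ i) = z $ i)"
        and Cz: "\<forall>c\<in>C. c \<bullet> z = 0"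
      \<comment> \<open>For \<open>n = 1\<close> the first branch also covers the second factor;
        reality of \<open>z\<close> then gives the value \<open>cnj (z $ i)\<close> required
        there.\<close>
      define x where "x = (\<lambda>(i, k). if k = n then z $ i else cnj (z $ i))"
      have x: "x (i, n) = z $ i" "x (i, 1) = cnj (z $ i)" if "i < d" for i
        using that real by (auto simp: x_def)
      have eval: "heis_eval x (q u) = (u \<bullet> z) * cnj (u \<bullet> z)" if "u \<in> carrier_vec d" for u
        using that z x unfolding q_def
        by (simp add: heis_eval_mult heis_eval_mode scalar_prod_def atLeast0LessThan)
      have "u \<bullet> z = 0" if u: "u \<in> ?U" for u
      proof -
        have "heis_eval x (q u) = 0"
        proof (rule heis_eval_span_eq_0)
          show "q u \<in> heis_span I" using I(3) u by blast
          fix p assume "p \<in> I"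
          then obtain c where c: "c \<in> C" "p = q c" using C(2) by blast
          then have "c \<in> carrier_vec d" using C(1) U by blast
          then show "heis_eval x p = 0" using eval Cz c by simp
        qed
        moreover have "u \<in> carrier_vec d" using u U by blast
        ultimately show ?thesis using eval[of u] by simp
      qed
      \<comment> \<open>A second evaluation, now linear in \<open>z\<close>, transfers the vanishing
        from eigenvectors to all vectors of E through the span of their modes.\<close>
      moreover have eval1: "heis_eval (\<lambda>(i, k). z $ i) (mode d v 1) = v \<bullet> z" for v
        using z by (simp add: heis_eval_mode scalar_prod_def atLeast0LessThan)
      ultimately have "heis_eval (\<lambda>(i, k). z $ i) p = 0" if "p \<in> (\<lambda>v. mode d v 1) ` ?U" for p
        using that by auto
      then have "heis_eval (\<lambda>(i, k). z $ i) (mode d v 1) = 0" if "v \<in> carrier_vec d" for v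
        using unitary_eigenvectors_span[OF G \<rho>, of 1] that by (blast intro: heis_eval_span_eq_0)
      then have "unit_vec d i \<bullet> z = 0" for i
        unfolding eval1 by simp
      then show "z = 0\<^sub>v d"
        using z scalar_prod_left_unit[OF z] by (intro eq_vecI) (metis carrier_vecD index_zero_vec, simp)
    qed
  qed
qed

text \<open>A smaller dimension would leave fewer than \<open>d\<close> complex equations, which
  have a nonzero solution; for \<open>n\<close> at least 2 no reality condition is imposed on
  it.\<close>

lemma heis_dim_invariants_ge:
  fixes G :: "('g, 'b) monoid_scheme"
  assumes G: "comm_group G" "finite (carrier G)" and \<rho>: "\<rho> \<in> hom G (orthogonal_group d)" and n: "n \<ge> 2"
  shows "d \<le> heis_dim (heis_invariants d (Suc n) G \<rho>)"
proof (rule ccontr)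
  assume less: "\<not> ?thesis"
  from n have "n \<ge> 1" by simp
  obtain C where C: "finite C" "C \<subseteq> carrier_vec d" "card C \<le> heis_dim (heis_invariants d (Suc n) G \<rho>)"
    "\<forall>z\<in>carrier_vec d. (n = 1 \<longrightarrow> (\<forall>i<d. cnj (z $ i) = z $ i)) \<longrightarrow>
      (\<forall>c\<in>C. c \<bullet> z = 0) \<longrightarrow> z = 0\<^sub>v d"
    by (rule heis_invariants_separating_vectors[OF G \<rho> \<open>n \<ge> 1\<close>])
  obtain z where "z \<in> carrier_vec d" "z \<noteq> 0\<^sub>v d" "\<And>c. c \<in> C \<Longrightarrow> c \<bullet> z = 0"
    by (rule homogeneous_system_nonzero_solution[OF C(1,2)]) (use C(3) less in auto)
  then show False using C(4) n by simp
qed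

lemma heis_dim_invariants_2_ge:
  fixes G :: "('g, 'b) monoid_scheme"
  assumes G: "comm_group G" "finite (carrier G)" and \<rho>: "\<rho> \<in> hom G (orthogonal_group d)"
  shows "d \<le> 2 * heis_dim (heis_invariants d 2 G \<rho>)"
proof (rule ccontr)
  assume less: "\<not> ?thesis"
  obtain C where C: "finite C" "C \<subseteq> carrier_vec d" "card C \<le> heis_dim (heis_invariants d (Suc 1) G \<rho>)"
    "\<forall>z\<in>carrier_vec d. (1 = (1::nat) \<longrightarrow> (\<forall>i<d. cnj (z $ i) = z $ i)) \<longrightarrow>
      (\<forall>c\<in>C. c \<bullet> z = 0) \<longrightarrow> z = 0\<^sub>v d"
    by (rule heis_invariants_separating_vectors[OF G \<rho> order_refl])
  \<comment> \<open>On real \<open>z\<close> each complex equation amounts to two real ones, so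
    there are at most twice as many, still fewer than \<open>d\<close>.\<close>
  let ?C = "map_vec Re ` C \<union> map_vec Im ` C"
  have "card ?C \<le> card C + card C"
    using card_Un_le card_image_le[OF C(1)] by (meson add_mono order_trans)
  then have "card ?C < d" using C(3) less by (simp add: numeral_2_eq_2)
  then obtain z where z: "z \<in> carrier_vec d" "z \<noteq> 0\<^sub>v d" "\<And>c. c \<in> ?C \<Longrightarrow> c \<bullet> z = 0"
    by (rule homogeneous_system_nonzero_solution[of ?C d, rotated 2]) (use C(1,2) in auto)
  have "map_vec complex_of_real z = 0\<^sub>v d"
  proof (rule C(4)[rule_format])
    fix c assume c: "c \<in> C"
    then have "map_vec Re c \<bullet> z = 0" "map_vec Im c \<bullet> z = 0" using z(3) by auto
    then show "c \<bullet> map_vec complex_of_real z = 0"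
      using c C(2) z(1) by (auto simp: scalar_prod_def complex_eq_iff)
  qed (use z in auto)
  then have "z = 0\<^sub>v d"
    using z(1) by (intro eq_vecI) (auto dest!: arg_cong[of _ _ "\<lambda>v. v $ _"] simp: vec_eq_iff)
  with z(2) show False ..
qed

section \<open>A cyclic group attaining the bounds\<close>

text \<open>The angles change sign under \<open>i \<mapsto> d - 1 - i\<close>, so the matrix below rotates the plane spanned by
  \<open>e\<^sub>i\<close> and \<open>e\<^sub>d\<^sub>-\<^sub>1\<^sub>-\<^sub>i\<close>; the real parameter \<open>t\<close> is the exponent of the generator.\<close>

definition rotation_angle :: "nat \<Rightarrow> nat \<Rightarrow> real" where
  "rotation_angle d i = 2 * pi * real_of_int (2 * int i + 1 - int d) / real (2 * d + 2)"

lemma rotation_angle_reflect: "i < d \<Longrightarrow> rotation_angle d (d - Suc i) = - rotation_angle d i"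
  by (simp add: rotation_angle_def of_nat_diff field_simps)

definition rotation_mat :: "nat \<Rightarrow> real \<Rightarrow> real mat" where
  "rotation_mat d t = mat d d (\<lambda>(i, j).
     (if i = j then cos (t * rotation_angle d i) else 0) +
     (if j = d - Suc i then sin (t * rotation_angle d i) else 0))"

lemma rotation_mat_carrier [simp]: "rotation_mat d t \<in> carrier_mat d d"
  by (simp add: rotation_mat_def)

lemma rotation_mat_mult: "rotation_mat d s * rotation_mat d t = rotation_mat d (s + t)"
proof (rule eq_matI)
  fix i j assume "i < dim_row (rotation_mat d (s + t))" "j < dim_col (rotation_mat d (s + t))"
  then have ij: "i < d" "j < d" by (simp_all add: rotation_mat_def)
  \<comment> \<open>Row \<open>i\<close> can be nonzero only in columns \<open>i\<close> and
    \<open>r\<close>, and row \<open>r\<close> carries the opposite angle; the product then reduces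
    to the addition formulas.\<close>
  define r where "r = d - Suc i"
  have r: "r < d" "d - Suc r = i" "rotation_angle d r = - rotation_angle d i"
    using ij by (auto simp: r_def rotation_angle_reflect)
  let ?a = "rotation_angle d i"
  have "(rotation_mat d s * rotation_mat d t) $$ (i, j) =
      (\<Sum>k<d. rotation_mat d s $$ (i, k) * rotation_mat d t $$ (k, j))"
    using ij by (simp add: rotation_mat_def scalar_prod_def atLeast0LessThan)
  also have "\<dots> = (\<Sum>k<d. (if k = i then cos (s * ?a) * rotation_mat d t $$ (i, j) else 0) +
      (if k = r then sin (s * ?a) * rotation_mat d t $$ (r, j) else 0))"
    using ij by (intro sum.cong) (auto simp: rotation_mat_def r_def algebra_simps)
  also have "\<dots> = cos (s * ?a) * rotation_mat d t $$ (i, j) + sin (s * ?a) * rotation_mat d t $$ (r, j)"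
    using ij r by (simp add: sum.distrib)
  also have "\<dots> = rotation_mat d (s + t) $$ (i, j)"
  proof -
    have e1: "rotation_mat d t $$ (i, j) = (if j = i then cos (t * ?a) else 0) + (if j = r then sin (t * ?a) else 0)" for t
      using ij by (simp add: rotation_mat_def r_def)
    have e2: "rotation_mat d t $$ (r, j) = (if j = r then cos (t * ?a) else 0) - (if j = i then sin (t * ?a) else 0)" for t
      using ij r by (simp add: rotation_mat_def)
    show ?thesis
      by (simp only: e1 e2) (simp add: cos_add sin_add algebra_simps)
  qed
  finally show "(rotation_mat d s * rotation_mat d t) $$ (i, j) = rotation_mat d (s + t) $$ (i, j)" .
qed (simp_all add: rotation_mat_def)

text \<open>Transposition exchanges the sines of mirror indices, whose angles are opposite. With the
  product rule this gives orthogonality.\<close>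

lemma rotation_mat_transpose: "transpose_mat (rotation_mat d t) = rotation_mat d (- t)"
proof (rule eq_matI)
  fix i j assume "i < dim_row (rotation_mat d (- t))" "j < dim_col (rotation_mat d (- t))"
  then have ij: "i < d" "j < d" by (simp_all add: rotation_mat_def)
  then have "i = d - Suc j \<longleftrightarrow> j = d - Suc i" by auto
  with ij show "transpose_mat (rotation_mat d t) $$ (i, j) = rotation_mat d (- t) $$ (i, j)"
    by (auto simp: rotation_mat_def rotation_angle_reflect)
qed (simp_all add: rotation_mat_def)

lemma rotation_mat_int_period:
  assumes "even d" "t = real (2 * d + 2) * real_of_int k"
  shows "rotation_mat d t = 1\<^sub>m d"
proof (rule eq_matI)
  fix i j assume "i < dim_row (1\<^sub>m d :: real mat)" "j < dim_col (1\<^sub>m d :: real mat)"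
  then have ij: "i < d" "j < d" by simp_all
  have "t * rotation_angle d i = 2 * pi * real_of_int (k * (2 * int i + 1 - int d))"
    unfolding assms(2) rotation_angle_def by (simp del: of_nat_add of_nat_mult of_int_diff)
  then have "cos (t * rotation_angle d i) = 1" "sin (t * rotation_angle d i) = 0"
    by (simp_all only: cos_int_2pin sin_int_2pin)
  with ij show "rotation_mat d t $$ (i, j) = 1\<^sub>m d $$ (i, j)"
    by (cases "i = j") (simp_all add: rotation_mat_def)
qed (simp_all add: rotation_mat_def)

lemma rotation_mat_0: "even d \<Longrightarrow> rotation_mat d 0 = 1\<^sub>m d"
  by (rule rotation_mat_int_period[of _ _ 0]) auto

lemma rotation_mat_orthogonal: "even d \<Longrightarrow> rotation_mat d t \<in> carrier (orthogonal_group d)"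
  by (simp add: orthogonal_group_def rotation_mat_transpose rotation_mat_mult rotation_mat_0)

section \<open>The cyclic group and its action by rotations\<close>

definition cyclic_add_group :: "nat \<Rightarrow> nat monoid" where
  "cyclic_add_group n = \<lparr>carrier = {..<n}, mult = (\<lambda>a b. (a + b) mod n), one = 0\<rparr>"

lemma comm_group_cyclic_add_group: "n > 0 \<Longrightarrow> comm_group (cyclic_add_group n)"
proof (rule comm_groupI)
  fix a assume "n > 0" "a \<in> carrier (cyclic_add_group n)"
  then show "\<exists>b\<in>carrier (cyclic_add_group n). b \<otimes>\<^bsub>cyclic_add_group n\<^esub> a = \<one>\<^bsub>cyclic_add_group n\<^esub>"
    \<comment> \<open>For \<open>a = 0\<close> the difference is \<open>n\<close>, which the
      reduction takes back into the carrier.\<close>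
    by (intro bexI[of _ "(n - a) mod n"]) (auto simp: cyclic_add_group_def mod_add_left_eq)
qed (auto simp: cyclic_add_group_def mod_add_left_eq mod_add_right_eq add.assoc add.commute
    add.left_commute)

lemma rotation_mat_hom:
  assumes "even d"
  shows "(\<lambda>k. rotation_mat d (real k)) \<in> hom (cyclic_add_group (2 * d + 2)) (orthogonal_group d)"
proof (rule homI)
  fix a b assume "a \<in> carrier (cyclic_add_group (2 * d + 2))" "b \<in> carrier (cyclic_add_group (2 * d + 2))"
  let ?N = "2 * d + 2"
  \<comment> \<open>The sum differs from its residue by a multiple of the period, and that multiple
    acts as the identity.\<close>
  have "real (a + b) = real ((a + b) mod ?N) + real ?N * real_of_int (int ((a + b) div ?N))"
    by (metis mod_mult_div_eq of_int_of_nat_eq of_nat_add of_nat_mult)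
  then have "rotation_mat d (real (a + b)) = rotation_mat d (real ((a + b) mod ?N)) *
      rotation_mat d (real ?N * real_of_int (int ((a + b) div ?N)))"
    by (simp only: rotation_mat_mult)
  also have "\<dots> = rotation_mat d (real ((a + b) mod ?N))"
    by (subst rotation_mat_int_period[OF assms refl]) (rule right_mult_one_mat[of _ d], simp)
  finally show "rotation_mat d (real (a \<otimes>\<^bsub>cyclic_add_group ?N\<^esub> b)) =
      rotation_mat d (real a) \<otimes>\<^bsub>orthogonal_group d\<^esub> rotation_mat d (real b)"
    by (simp add: cyclic_add_group_def orthogonal_group_def rotation_mat_mult)
qed (rule rotation_mat_orthogonal[OF assms])

text \<open>For \<open>i < d\<close> the vector of the mirror index \<open>d - Suc i\<close> is
  \<open>\<i>\<close> times the conjugate of this one, so mirror indices give both eigenvectors of a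
  rotation plane.\<close>

definition rotation_eigenvector :: "nat \<Rightarrow> nat \<Rightarrow> complex vec" where
  "rotation_eigenvector d i = unit_vec d i + \<i> \<cdot>\<^sub>v unit_vec d (d - Suc i)"

lemma rotation_eigenvector_eigen:
  assumes "even d" and i: "i < d"
  shows "map_mat complex_of_real (rotation_mat d t) *\<^sub>v rotation_eigenvector d i =
    cis (t * rotation_angle d i) \<cdot>\<^sub>v rotation_eigenvector d i"
proof (rule eq_vecI)
  let ?R = "map_mat complex_of_real (rotation_mat d t)"
  fix j assume "j < dim_vec (cis (t * rotation_angle d i) \<cdot>\<^sub>v rotation_eigenvector d i)"
  then have j: "j < d" by (simp add: rotation_eigenvector_def)
  define r where "r = d - Suc i"
  \<comment> \<open>Evenness of \<open>d\<close> excludes an index that is its own mirror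
    image.\<close>
  have r: "r < d" "i \<noteq> r" using i \<open>even d\<close> by (auto simp: r_def) presburger
  have "(?R *\<^sub>v rotation_eigenvector d i) $ j = (\<Sum>k<d. ?R $$ (j, k) * rotation_eigenvector d i $ k)"
    using j by (simp add: scalar_prod_def atLeast0LessThan rotation_mat_def rotation_eigenvector_def)
  also have "\<dots> = (\<Sum>k<d. (if k = i then ?R $$ (j, i) else 0) + (if k = r then \<i> * ?R $$ (j, r) else 0))"
    using i r by (intro sum.cong) (auto simp: rotation_eigenvector_def r_def)
  also have "\<dots> = ?R $$ (j, i) + \<i> * ?R $$ (j, r)"
    using i r by (simp add: sum.distrib)
  also have "\<dots> = (cis (t * rotation_angle d i) \<cdot>\<^sub>v rotation_eigenvector d i) $ j"
  proof -
    have *: "i = d - Suc j \<longleftrightarrow> j = r" "r = d - Suc j \<longleftrightarrow> j = i" using i j by (auto simp: r_def)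
    have ang: "rotation_angle d r = - rotation_angle d i" using i by (simp add: r_def rotation_angle_reflect)
    show ?thesis
      using i j r ang by (auto simp: rotation_mat_def rotation_eigenvector_def * r_def[symmetric] complex_eq_iff)
  qed
  finally show "(?R *\<^sub>v rotation_eigenvector d i) $ j = (cis (t * rotation_angle d i) \<cdot>\<^sub>v rotation_eigenvector d i) $ j" .
qed (simp add: rotation_mat_def rotation_eigenvector_def)

lemma rotation_eigenvector_carrier [simp]: "rotation_eigenvector d i \<in> carrier_vec d"
  by (simp add: rotation_eigenvector_def)

lemma mode_in_span_rotation_eigenvectors:
  assumes "even d"
  shows "mode d v n \<in> heis_span ((\<lambda>i. mode d (rotation_eigenvector d i) n) ` {..<d})"
proof -
  let ?w = "\<lambda>i. mode d (rotation_eigenvector d i) n"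
  have "mode d (unit_vec d i) n \<in> heis_span (?w ` {..<d})" if i: "i < d" for i
  proof -
    have "d - Suc i \<noteq> i" using i \<open>even d\<close> by presburger
    \<comment> \<open>Subtracting \<open>\<i>\<close> times the mirror eigenvector cancels the
      second coordinate and doubles the first.\<close>
    have "unit_vec d i = (1/2) \<cdot>\<^sub>v (rotation_eigenvector d i + (- \<i>) \<cdot>\<^sub>v rotation_eigenvector d (d - Suc i))"
      using i \<open>d - Suc i \<noteq> i\<close> by (intro eq_vecI) (auto simp: rotation_eigenvector_def Suc_diff_Suc)
    then have "mode d (unit_vec d i) n = heis_scale (1/2) (?w i + heis_scale (- \<i>) (?w (d - Suc i)))"
      by (simp only: mode_add mode_smult rotation_eigenvector_carrier smult_carrier_vec add_carrier_vec)
    moreover have "?w j \<in> heis_span (?w ` {..<d})" if "j < d" for j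
      using that by (intro heis.span_base) auto
    ultimately show ?thesis
      using i by (auto intro!: heis.span_scale heis.span_diff)
  qed
  then show ?thesis
    by (subst mode_eq_sum_unit_modes) (rule heis.span_sum, rule heis.span_scale, simp)
qed

text \<open>A product of eigenvectors is an eigenvector of the generator, whose exponents add up.
  Projecting to the vectors fixed by the generator keeps the products whose total exponent is
  divisible by the group order.\<close>

lemma rotation_invariants_subset_span:
  assumes "even d"
  shows "heis_invariants d m (cyclic_add_group (2 * d + 2)) (\<lambda>k. rotation_mat d (real k)) \<subseteq>
    heis_span ((\<lambda>ts. \<Prod>(i, n)\<leftarrow>ts. mode d (rotation_eigenvector d i) n) `
      {ts. set ts \<subseteq> {..<d} \<times> {1..} \<and> (\<Sum>(i, n)\<leftarrow>ts. n) = m \<and>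
           int (2 * d + 2) dvd (\<Sum>(i, n)\<leftarrow>ts. 2 * int i + 1 - int d)})"
    (is "?V \<subseteq> heis_span (?b ` ?J)")
proof
  let ?I = "{ts. set ts \<subseteq> {..<d} \<times> {1..} \<and> (\<Sum>(i, n)\<leftarrow>ts. n) = m}"
  let ?N = "2 * d + 2"
  let ?s = "\<lambda>ts :: (nat \<times> nat) list. \<Sum>(i, n)\<leftarrow>ts. 2 * int i + 1 - int d"
  define c where "c = (\<lambda>ts. cis (2 * pi * real_of_int (?s ts) / real ?N))"
  fix p assume p: "p \<in> ?V"
  have "heis_act d (rotation_mat d 1) (?b ts) = heis_scale (c ts) (?b ts)" if "set ts \<subseteq> {..<d} \<times> {1..}" for ts
    using that
  proof (induction ts)
    case Nil
    then show ?case by (simp add: c_def)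
  next
    case (Cons a ts)
    obtain i n where a: "a = (i, n)" "i < d" using Cons by (cases a) auto
    have "c (a # ts) = cis (rotation_angle d i) * c ts"
      by (simp add: c_def a rotation_angle_def cis_mult add_divide_distrib distrib_left
          del: of_nat_add of_nat_mult)
    moreover have "heis_act d (rotation_mat d 1) (mode d (rotation_eigenvector d i) n) =
        heis_scale (cis (rotation_angle d i)) (mode d (rotation_eigenvector d i) n)"
      using rotation_eigenvector_eigen[OF assms a(2), of 1] by (simp add: heis_act_mode mode_smult)
    ultimately show ?case
      using Cons by (simp add: a heis_act_mult heis_scale_def mult_ac flip: mult_single[of 0 _ 0, simplified])
  qed
  moreover have "c ts ^ ?N = 1" for ts
  proof -
    have "c ts ^ ?N = cis (2 * pi * real_of_int (?s ts))"
      unfolding c_def DeMoivre by (simp del: of_nat_add of_nat_mult)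
    then show ?thesis by simp
  qed
  moreover have "heis_act d (rotation_mat d 1) p = p"
  proof -
    have "1 \<in> carrier (cyclic_add_group ?N)" by (simp add: cyclic_add_group_def)
    then show ?thesis using p unfolding heis_invariants_def by force
  qed
  moreover have "p \<in> heis_span (?b ` ?I)"
    using p heis_weight_subset_span[OF mode_in_span_rotation_eigenvectors[OF assms], of m]
    by (auto simp: heis_invariants_def)
  moreover have "of_nat ?N \<noteq> (0 :: complex)"
    unfolding of_nat_eq_0_iff by simp
  ultimately have "p \<in> heis_span (?b ` {ts \<in> ?I. c ts = 1})"
    by (intro heis.fixed_vector_in_span[OF linear_heis_act, of _ d "rotation_mat d 1" _ c ?N]) blast+
  moreover have "?b ` {ts \<in> ?I. c ts = 1} \<subseteq> ?b ` ?J"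
    using cis_eq_1_imp_dvd[of _ ?N] by (intro image_mono) (auto simp: c_def simp del: of_nat_add of_nat_mult)
  ultimately show "p \<in> heis_span (?b ` ?J)"
    using heis.span_mono by blast
qed

section \<open>Counting invariant monomials of weights 2 and 3\<close>

lemma positive_parts_2:
  assumes "set ts \<subseteq> A \<times> {1..}" "(\<Sum>(i, n)\<leftarrow>ts. n) = (2::nat)"
  shows "(\<exists>i\<in>A. ts = [(i, 2)]) \<or> (\<exists>i\<in>A. \<exists>j\<in>A. ts = [(i, 1), (j, 1)])"
proof (cases ts)
  case 1: (Cons a us)
  show ?thesis
  proof (cases us)
    case 2: (Cons b vs)
    show ?thesis
      using assms 1 2 by (cases vs) auto
  qed (use assms 1 in auto)
qed (use assms in auto)

lemma positive_parts_3:
  assumes "set ts \<subseteq> A \<times> {1..}" "(\<Sum>(i, n)\<leftarrow>ts. n) = (3::nat)"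
  shows "(\<exists>i\<in>A. ts = [(i, 3)]) \<or> (\<exists>i\<in>A. \<exists>j\<in>A. ts = [(i, 2), (j, 1)] \<or> ts = [(j, 1), (i, 2)]) \<or>
    (\<exists>i\<in>A. \<exists>j\<in>A. \<exists>k\<in>A. ts = [(i, 1), (j, 1), (k, 1)])"
proof (cases ts)
  case 1: (Cons a us)
  show ?thesis
  proof (cases us)
    case 2: (Cons b vs)
    obtain i n j m where ab: "a = (i, n)" "b = (j, m)" by fastforce
    show ?thesis
    proof (cases vs)
      case Nil
      then have "n = 1 \<and> m = 2 \<or> n = 2 \<and> m = 1" using assms 1 2 ab by auto
      then show ?thesis using assms 1 2 Nil ab by auto
    next
      case 3: (Cons c ws)
      show ?thesis using assms 1 2 3 by (cases ws) auto
    qed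
  qed (use assms 1 in auto)
qed (use assms in auto)

text \<open>Each exponent has absolute value at most \<open>d - 1\<close>, so the sum of two is too
  small to be a nonzero multiple of \<open>2 * d + 2\<close>.\<close>

lemma rotation_pair_weight:
  assumes "even d" "i < d" "j < d" "int (2 * d + 2) dvd (2 * int i + 1 - int d) + (2 * int j + 1 - int d)"
  shows "j = d - Suc i"
proof -
  let ?s = "(2 * int i + 1 - int d) + (2 * int j + 1 - int d)"
  have "\<bar>?s\<bar> < int (2 * d + 2)" using assms(2,3) by auto
  then have "?s = 0" using assms(4) dvd_imp_le_int[of ?s "int (2 * d + 2)"] by linarith
  then show ?thesis by linarith
qed

text \<open>The group order is even. For even \<open>d\<close> every exponent is odd, so this
  excludes monomials with one or three factors.\<close>

lemma rotation_odd_weight: "odd (s :: int) \<Longrightarrow> \<not> int (2 * d + 2) dvd s"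
  by (metis dvd_trans even_Suc_Suc_iff even_mult_iff even_of_nat add_2_eq_Suc' even_numeral)

lemma rotation_dim_2_le:
  assumes "even d"
  shows "heis_dim (heis_invariants d 2 (cyclic_add_group (2 * d + 2)) (\<lambda>k. rotation_mat d (real k))) \<le> d div 2"
    (is "heis_dim ?V \<le> _")
proof -
  let ?w = "\<lambda>i. mode d (rotation_eigenvector d i) 1"
  let ?W = "(\<lambda>i. ?w i * ?w (d - Suc i)) ` {..<d div 2}"
  \<comment> \<open>Both factors have mode 1, so mirror indices give the same product and half of
    the indices suffice.\<close>
  have W: "?w i * ?w (d - Suc i) \<in> ?W" if "i < d" for i
  proof (cases "i < d div 2")
    case False
    then have "d - Suc i < d div 2" "d - Suc (d - Suc i) = i" using that \<open>even d\<close> by auto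
    then show ?thesis by (metis (no_types, lifting) image_eqI lessThan_iff mult.commute)
  qed auto
  have "?V \<subseteq> heis_span ?W"
  proof (rule order_trans[OF rotation_invariants_subset_span[OF assms] heis.span_mono], safe)
    fix ts :: "(nat \<times> nat) list" assume ts: "set ts \<subseteq> {..<d} \<times> {1..}" "(\<Sum>(i, n)\<leftarrow>ts. n) = 2"
      and dvd: "int (2 * d + 2) dvd (\<Sum>(i, n)\<leftarrow>ts. 2 * int i + 1 - int d)"
    from positive_parts_2[OF ts] show "(\<Prod>(i, n)\<leftarrow>ts. mode d (rotation_eigenvector d i) n) \<in> ?W"
    proof (elim disjE bexE)
      fix i assume "ts = [(i, 2)]"
      with dvd show ?thesis using rotation_odd_weight[of "2 * int i + 1 - int d" d] \<open>even d\<close> by simp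
    next
      fix i j assume ij: "i \<in> {..<d}" "j \<in> {..<d}" and "ts = [(i, 1), (j, 1)]"
      with dvd have "j = d - Suc i" using \<open>even d\<close> by (intro rotation_pair_weight) auto
      with W[of i] ij \<open>ts = _\<close> show ?thesis by simp
    qed
  qed
  then have "heis_dim ?V \<le> card ?W" by (rule heis.dim_le_card) simp
  also have "\<dots> \<le> d div 2" using card_image_le[of "{..<d div 2}"] by simp
  finally show ?thesis .
qed

lemma rotation_dim_3_le:
  assumes "even d"
  shows "heis_dim (heis_invariants d 3 (cyclic_add_group (2 * d + 2)) (\<lambda>k. rotation_mat d (real k))) \<le> d"
    (is "heis_dim ?V \<le> _")
proof -
  let ?w = "\<lambda>i n. mode d (rotation_eigenvector d i) n"
  \<comment> \<open>The two modes differ, so mirror indices are counted separately and all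
    \<open>d\<close> indices occur.\<close>
  let ?W = "(\<lambda>i. ?w i 2 * ?w (d - Suc i) 1) ` {..<d}"
  have "?V \<subseteq> heis_span ?W"
  proof (rule order_trans[OF rotation_invariants_subset_span[OF assms] heis.span_mono], safe)
    fix ts :: "(nat \<times> nat) list" assume ts: "set ts \<subseteq> {..<d} \<times> {1..}" "(\<Sum>(i, n)\<leftarrow>ts. n) = 3"
      and dvd: "int (2 * d + 2) dvd (\<Sum>(i, n)\<leftarrow>ts. 2 * int i + 1 - int d)"
    from positive_parts_3[OF ts] show "(\<Prod>(i, n)\<leftarrow>ts. mode d (rotation_eigenvector d i) n) \<in> ?W"
    proof (elim disjE bexE)
      fix i assume "ts = [(i, 3)]"
      with dvd show ?thesis using rotation_odd_weight[of "2 * int i + 1 - int d" d] \<open>even d\<close> by simp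
    next
      fix i j assume ij: "i \<in> {..<d}" "j \<in> {..<d}" and "ts = [(i, 2), (j, 1)]"
      with dvd have "j = d - Suc i" using \<open>even d\<close> by (intro rotation_pair_weight) auto
      with ij \<open>ts = _\<close> show ?thesis by simp
    next
      fix i j assume ij: "i \<in> {..<d}" "j \<in> {..<d}" and "ts = [(j, 1), (i, 2)]"
      with dvd have "j = d - Suc i" using \<open>even d\<close> by (intro rotation_pair_weight) (auto simp: add.commute)
      with ij \<open>ts = _\<close> show ?thesis by (simp add: mult.commute)
    next
      fix i j k assume "ts = [(i, 1), (j, 1), (k, 1)]"
      with dvd show ?thesis
        using rotation_odd_weight[of "(2 * int i + 1 - int d) + ((2 * int j + 1 - int d) + (2 * int k + 1 - int d))" d]
          \<open>even d\<close> by simp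
    qed
  qed
  then have "heis_dim ?V \<le> card ?W" by (rule heis.dim_le_card) simp
  also have "\<dots> \<le> d" using card_image_le[of "{..<d}"] by simp
  finally show ?thesis .
qed

theorem lemma8p1:
  fixes d :: nat and L :: "real vec set"
  assumes "even_unimodular_lattice d L"
  shows
    "(\<forall>(G :: 'g monoid) \<rho>.
        comm_group G \<and> finite (carrier G) \<and> \<rho> \<in> hom G (orthogonal_group d) \<longrightarrow>
        real (heis_dim (heis_invariants d 2 G \<rho>)) \<ge> real d / 2 \<and>
        heis_dim (heis_invariants d 3 G \<rho>) \<ge> d) \<and>
     (\<exists>(G :: nat monoid) \<rho>.
        comm_group G \<and> finite (carrier G) \<and> \<rho> \<in> hom G (orthogonal_group d) \<and>
        real (heis_dim (heis_invariants d 2 G \<rho>)) = real d / 2) \<and>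
     (\<exists>(G :: nat monoid) \<rho>.
        comm_group G \<and> finite (carrier G) \<and> \<rho> \<in> hom G (orthogonal_group d) \<and>
        heis_dim (heis_invariants d 3 G \<rho>) = d)"
proof -
  \<comment> \<open>The lattice enters through the parity of its rank: for odd \<open>d\<close> the
    bound in weight 2 would not be an integer and could not be attained.\<close>
  have "even d" using assms by (rule even_unimodular_lattice_even_rank)
  let ?G = "cyclic_add_group (2 * d + 2)" and ?\<rho> = "\<lambda>k. rotation_mat d (real k)"
  have G: "comm_group ?G" "finite (carrier ?G)" "?\<rho> \<in> hom ?G (orthogonal_group d)"
    by (rule comm_group_cyclic_add_group, simp) (simp add: cyclic_add_group_def, rule rotation_mat_hom[OF \<open>even d\<close>])
  have "heis_dim (heis_invariants d 2 ?G ?\<rho>) = d div 2"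
    using heis_dim_invariants_2_ge[OF G] rotation_dim_2_le[OF \<open>even d\<close>] by linarith
  then have "real (heis_dim (heis_invariants d 2 ?G ?\<rho>)) = real d / 2"
    using \<open>even d\<close> by (simp add: real_of_nat_div)
  moreover have "heis_dim (heis_invariants d 3 ?G ?\<rho>) = d"
    using heis_dim_invariants_ge[OF G, of 2] rotation_dim_3_le[OF \<open>even d\<close>] by simp
  moreover have "real (heis_dim (heis_invariants d 2 G \<rho>)) \<ge> real d / 2"
    if "comm_group G" "finite (carrier G)" "\<rho> \<in> hom G (orthogonal_group d)" for G :: "'g monoid" and \<rho>
    using heis_dim_invariants_2_ge[OF that] by linarith
  moreover have "heis_dim (heis_invariants d 3 G \<rho>) \<ge> d"
    if "comm_group G" "finite (carrier G)" "\<rho> \<in> hom G (orthogonal_group d)" for G :: "'g monoid" and \<rho>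
    using heis_dim_invariants_ge[OF that, of 2] by simp
  ultimately show ?thesis using G by blast
qed

end
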